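(* Let $0<p<\infty$ and let $\mu$ be a positive Borel measure on $[0,1)$. Suppose that one of the following two conditions holds: (i) $0<p\le 1$ and $\mu$ is a $1/p$-Carleson measure; (ii) $1<p<\infty$ and $\mu$ is a $1$-Carleson measure. Then for every $f(z)=\sum_{k=0}^\infty a_k z^k\in H^p$ the power series $$\mathcal{DH}_\mu(f)(z)=\sum_{n=0}^\infty (n+1)\Big(\sum_{k=0}^\infty \mu_{n+k}a_k\Big)z^n$$ is a well-defined analytic function in $\mathbb{D}$ (that is, each inner series converges and the resulting power series in $z$ converges in $\mathbb{D}$). Furthermore, in these cases, for every $f\in H^p$ and every $z\in\mathbb{D}$, $$\mathcal{DH}_\mu(f)(z)=\int_{[0,1)}\frac{f(t)}{(1-tz)^2}\,d\mu(t).$$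
   Context: $\mathbb{D}$ is the open unit disc in $\mathbb{C}$. For $0<p<\infty$, the Hardy space $H^p$ consists of all analytic $f$ on $\mathbb{D}$ with $\|f\|_{H^p}=\sup_{0<r<1}\left(\frac1{2\pi}\int_0^{2\pi}|f(re^{i\theta})|^p\,d\theta\right)^{1/p}<\infty$. For a positive Borel measure $\mu$ on $[0,1)$, $\mu_n=\int_{[0,1)}t^n\,d\mu(t)$ for $n\ge 0$. For $s>0$, a positive Borel measure $\mu$ on $[0,1)$ is an $s$-Carleson measure if there is a constant $C>0$ with $\mu([t,1))\le C(1-t)^s$ for all $0\le t<1$. *)

theory Defs
  imports "HOL-Complex_Analysis.Complex_Analysis"
begin

text \<open>Only used for \<open>f\<close> analytic on the disc, where the integrand is continuous in \<open>\<theta>\<close>, so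
  the gauge integral is the ordinary one. The supremum is taken in \<open>[0, \<infinity>]\<close>.\<close>

definition hardy_norm :: "real \<Rightarrow> (complex \<Rightarrow> complex) \<Rightarrow> ennreal" where
  "hardy_norm p f =
     (SUP r\<in>{0<..<1::real}. ennreal
        ((1 / (2 * pi) * integral {0..2 * pi} (\<lambda>\<theta>. norm (f (of_real r * cis \<theta>)) powr p))
           powr (1 / p)))"

definition hardy_space :: "real \<Rightarrow> (complex \<Rightarrow> complex) set" where
  "hardy_space p = {f. f analytic_on ball 0 1 \<and> hardy_norm p f < \<infinity>}"

definition borel_measure_on_unit :: "real measure \<Rightarrow> bool" where
  "borel_measure_on_unit \<mu> \<longleftrightarrow> sets \<mu> = sets (restrict_space borel {0..<1})"

definition carleson_measure :: "real \<Rightarrow> real measure \<Rightarrow> bool" where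
  "carleson_measure s \<mu> \<longleftrightarrow>
     borel_measure_on_unit \<mu> \<and>
     (\<exists>C>0. \<forall>t. 0 \<le> t \<and> t < 1 \<longrightarrow> emeasure \<mu> {t..<1} \<le> ennreal (C * (1 - t) powr s))"

text \<open>A Carleson measure is finite (take \<open>t = 0\<close> in the definition), so its
  moments are not affected by the convention that a non-integrable function has Bochner
  integral \<open>0\<close>.\<close>

definition moment :: "real measure \<Rightarrow> nat \<Rightarrow> real" where
  "moment \<mu> n = (LINT t|\<mu>. t ^ n)"

text \<open>\<open>a\<close> is the sequence of Taylor coefficients at \<open>0\<close> of the function the operator acts on.\<close>

definition DH_coeff :: "real measure \<Rightarrow> (nat \<Rightarrow> complex) \<Rightarrow> nat \<Rightarrow> complex" where
  "DH_coeff \<mu> a n = of_nat (n + 1) * (\<Sum>k. of_real (moment \<mu> (n + k)) * a k)"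

definition DH :: "real measure \<Rightarrow> (nat \<Rightarrow> complex) \<Rightarrow> complex \<Rightarrow> complex" where
  "DH \<mu> a z = (\<Sum>n. DH_coeff \<mu> a n * z ^ n)"

end

theory Submission
  imports Defs "HOL-Computational_Algebra.Fundamental_Theorem_Algebra"
begin

text \<open>Everything follows from absolute convergence, \<open>\<Sum>k. \<bar>a\<^sub>k\<bar> \<mu>\<^sub>k < \<infinity>\<close>, which makes both
  interchanges of sum and integral legitimate. Since \<open>\<mu>\<^sub>k = O((k + 1)\<^sup>-\<^sup>\<sigma>)\<close> for a
  \<open>\<sigma>\<close>-Carleson measure and \<open>H\<^sup>p\<close> lies in \<open>H\<^sup>1\<close> for \<open>p > 1\<close>, it suffices to show that
  \<open>\<Sum>k. \<bar>a\<^sub>k\<bar> (k + 1) powr (- 1 / q)\<close> converges for \<open>f\<close> in \<open>H\<^sup>q\<close> with \<open>q \<le> 1\<close>.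

  It is enough to bound this sum for polynomials \<open>P\<close> (dilated partial sums of \<open>f\<close>) without zeros on the
  unit circle. Reflecting the zeros inside the disc gives a polynomial \<open>g\<close> without zeros on a
  neighbourhood of the closed disc and with \<open>\<bar>g\<bar> = \<bar>P\<bar>\<close> on the circle. With \<open>u = g powr (q / 2)\<close>,
  \<open>v = u powr (1 + 2 * s)\<close>, \<open>s = 1 / q - 1\<close>, one has \<open>P = \<phi> v\<close> where \<open>\<phi>\<close> and \<open>u\<close> lie in \<open>H\<^sup>2\<close>. The
  identity \<open>v' = (1 + 2 * s) u powr (2 * s) u'\<close> and the pointwise growth bound for \<open>u\<close> show that
  \<open>(j + 1) powr (- s) v\<^sub>j\<close> is square summable, and Hilbert's inequality applied to the Cauchy product
  \<open>\<phi> v\<close> finishes the proof.\<close>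

section \<open>Hilbert's inequality\<close>

text \<open>The right-hand side is the increment of a primitive of \<open>2 / (sqrt t * (sqrt a + sqrt t)\<^sup>2)\<close>,
  which is comparable to the summand in Schur's test for the Hilbert matrix.\<close>

lemma telescoping_sqrt_le:
  fixes a t :: real
  assumes "0 < a" "1 \<le> t"
  shows "1 / ((a + t) * sqrt t) \<le>
     4 / sqrt a * (sqrt t / (sqrt a + sqrt t) - sqrt (t - 1) / (sqrt a + sqrt (t - 1)))"
proof -
  define b u w where "b = sqrt a" and "u = sqrt t" and "w = sqrt (t - 1)"
  have pos: "b > 0" "u > 0" "w \<ge> 0" "w \<le> u" and sq: "a = b\<^sup>2" "t = u\<^sup>2" "w\<^sup>2 = u\<^sup>2 - 1"
    using assms by (auto simp: b_def u_def w_def)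
  have diff: "u / (b + u) - w / (b + w) = b * (u - w) / ((b + u) * (b + w))"
    using pos by (simp add: field_simps)
  have "(u - w) * (u + w) = 1" using sq by (simp add: power2_eq_square algebra_simps)
  then have "1 \<le> (u - w) * (2 * u)"
    using pos by (smt (verit) mult_left_mono)
  moreover have "(b + u) * (b + w) \<le> 2 * (b\<^sup>2 + u\<^sup>2)"
  proof -
    have "(b + u) * (b + w) \<le> (b + u) * (b + u)" using pos by (intro mult_left_mono) auto
    also have "\<dots> \<le> 2 * (b\<^sup>2 + u\<^sup>2)"
      using sum_squares_ge_zero[of "b - u" 0] by (simp add: power2_eq_square algebra_simps)
    finally show ?thesis .
  qed
  ultimately have "(b + u) * (b + w) * 1 \<le> 2 * (b\<^sup>2 + u\<^sup>2) * ((u - w) * (2 * u))"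
    using pos by (intro mult_mono[of "(b + u) * (b + w)"]) auto
  moreover define D S where "D = (b + u) * (b + w)" and "S = b\<^sup>2 + u\<^sup>2"
  ultimately have "D \<le> 4 * (u - w) * (S * u)" by (simp add: algebra_simps)
  moreover have "D > 0" "S > 0" using pos by (auto simp: D_def S_def add_pos_nonneg)
  ultimately have "1 / (S * u) \<le> 4 / b * (b * (u - w) / D)"
    using pos by (simp add: divide_simps mult.commute)
  then have "1 / ((a + t) * u) \<le> 4 / b * (u / (b + u) - w / (b + w))"
    by (simp only: diff D_def S_def sq(1,2))
  then show ?thesis
    by (simp only: b_def u_def w_def)
qed

text \<open>The row sum for Schur's test on the Hilbert matrix with weight
  \<open>1 / sqrt (j + 1)\<close>. It telescopes by \<open>telescoping_sqrt_le\<close>, and the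
  increments of \<open>F\<close> add up to at most 1.\<close>

lemma hilbert_schur_weight:
  "(\<Sum>j<N. 1 / (real (i + j + 1) * sqrt (real (j + 1)))) \<le> 8 / sqrt (real (i + 1))"
proof -
  define a where "a = real (i + 1)"
  define F where "F = (\<lambda>j::nat. sqrt (real j) / (sqrt a + sqrt (real j)))"
  have a: "a > 0" by (simp add: a_def)
  have "(\<Sum>j<N. 1 / (real (i + j + 1) * sqrt (real (j + 1))))
      \<le> (\<Sum>j<N. 8 / sqrt a * (F (Suc j) - F j))"
  proof (rule sum_mono)
    fix j
    \<comment> \<open>Here \<open>a + real (j + 1)\<close> is \<open>i + j + 2\<close>, at most
      twice \<open>i + j + 1\<close>; this factor 2 turns the constant 4 into 8.\<close>
    have "(a + real (j + 1)) * sqrt (real (j + 1)) \<le> 2 * real (i + j + 1) * sqrt (real (j + 1))"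
      by (intro mult_right_mono) (auto simp: a_def)
    then have "1 / (real (i + j + 1) * sqrt (real (j + 1))) \<le>
        2 * (1 / ((a + real (j + 1)) * sqrt (real (j + 1))))"
      using a by (simp add: divide_simps add_pos_nonneg)
    also have "\<dots> \<le> 2 * (4 / sqrt a * (F (Suc j) - F j))"
      using telescoping_sqrt_le[OF a, of "real (j + 1)"]
      by (intro mult_left_mono) (auto simp: F_def add.commute)
    finally show "1 / (real (i + j + 1) * sqrt (real (j + 1))) \<le> 8 / sqrt a * (F (Suc j) - F j)"
      by simp
  qed
  also have "\<dots> = 8 / sqrt a * (F N - F 0)"
    by (simp only: sum_distrib_left[symmetric] sum_lessThan_telescope)
  also have "\<dots> \<le> 8 / sqrt a * 1"
    using a by (intro mult_left_mono) (auto simp: F_def divide_simps not_less add_nonneg_nonneg)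
  finally show ?thesis by (simp add: a_def)
qed

text \<open>Schur's test in additive form: each product is split by a weighted AM-GM inequality, and
  the two halves are controlled by \<open>hilbert_schur_weight\<close> along rows and columns. Sums
  of squares on the right, instead of a product of norms, suffice for the later bounds.\<close>

lemma hilbert_inequality_AM:
  fixes x y :: "nat \<Rightarrow> real"
  shows "(\<Sum>i<N. \<Sum>j<N. x i * y j / real (i + j + 1)) \<le> 4 * (\<Sum>i<N. (x i)\<^sup>2) + 4 * (\<Sum>j<N. (y j)\<^sup>2)"
proof -
  let ?r = "\<lambda>i::nat. sqrt (real (i + 1))"
  let ?K = "\<lambda>i j. 1 / (real (i + j + 1) * ?r j)"
  have schur: "(\<Sum>i<N. \<Sum>j<N. (z i)\<^sup>2 * ?r i * ?K i j) \<le> 8 * (\<Sum>i<N. (z i)\<^sup>2)" for z :: "nat \<Rightarrow> real"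
  proof -
    have "(\<Sum>i<N. \<Sum>j<N. (z i)\<^sup>2 * ?r i * ?K i j) = (\<Sum>i<N. (z i)\<^sup>2 * ?r i * (\<Sum>j<N. ?K i j))"
      by (simp only: sum_distrib_left)
    also have "\<dots> \<le> (\<Sum>i<N. (z i)\<^sup>2 * ?r i * (8 / ?r i))"
      by (intro sum_mono mult_left_mono hilbert_schur_weight) auto
    also have "\<dots> = 8 * (\<Sum>i<N. (z i)\<^sup>2)"
      by (simp add: sum_distrib_left mult.commute)
    finally show ?thesis .
  qed
  have "(\<Sum>i<N. \<Sum>j<N. x i * y j / real (i + j + 1)) \<le>
      (\<Sum>i<N. \<Sum>j<N. ((x i)\<^sup>2 * ?r i * ?K i j + (y j)\<^sup>2 * ?r j * ?K j i) / 2)"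
  proof (intro sum_mono)
    fix i j
    define p q where "p = ?r i" and "q = ?r j"
    have pos: "p > 0" "q > 0" by (auto simp: p_def q_def)
    have "2 * (x i * y j) * (p * q) \<le> (x i)\<^sup>2 * p\<^sup>2 + (y j)\<^sup>2 * q\<^sup>2"
      using zero_le_power2[of "x i * p - y j * q"] by (simp add: power2_eq_square algebra_simps)
    then have "x i * y j \<le> ((x i)\<^sup>2 * (p / q) + (y j)\<^sup>2 * (q / p)) / 2"
      using pos by (simp add: field_simps power2_eq_square)
    moreover define d where "d = real (i + j + 1)"
    ultimately have "x i * y j / d \<le> ((x i)\<^sup>2 * (p / q) + (y j)\<^sup>2 * (q / p)) / 2 / d"
      by (intro divide_right_mono) auto
    also have "\<dots> = ((x i)\<^sup>2 * p * (1 / (d * q)) + (y j)\<^sup>2 * q * (1 / (d * p))) / 2"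
      using pos by (simp add: d_def divide_simps) (simp add: algebra_simps)
    also have "d * p = real (j + i + 1) * p"
      by (simp add: d_def)
    finally show "x i * y j / real (i + j + 1) \<le> ((x i)\<^sup>2 * ?r i * ?K i j + (y j)\<^sup>2 * ?r j * ?K j i) / 2"
      unfolding p_def q_def d_def .
  qed
  also have "\<dots> = ((\<Sum>i<N. \<Sum>j<N. (x i)\<^sup>2 * ?r i * ?K i j) + (\<Sum>j<N. \<Sum>i<N. (y j)\<^sup>2 * ?r j * ?K j i)) / 2"
    using sum.swap[of "\<lambda>j i. (y j)\<^sup>2 * ?r j * ?K j i" "{..<N}" "{..<N}"]
    by (simp only: sum.distrib add_divide_distrib flip: sum_divide_distrib)
  also have "\<dots> \<le> (8 * (\<Sum>i<N. (x i)\<^sup>2) + 8 * (\<Sum>j<N. (y j)\<^sup>2)) / 2"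
    by (intro divide_right_mono add_mono schur) auto
  finally show ?thesis by simp
qed

section \<open>Means over circles and Parseval's identity\<close>

text \<open>Stated for an arbitrary real function, so that one notion serves
  \<open>norm (f z) powr p\<close>, squared moduli and cross terms. For the first of these it is the
  quantity inside the outer power in \<open>hardy_norm\<close>.\<close>

definition circle_mean :: "(complex \<Rightarrow> real) \<Rightarrow> real \<Rightarrow> real" where
  "circle_mean F r = 1 / (2 * pi) * integral {0..2 * pi} (\<lambda>\<theta>. F (of_real r * cis \<theta>))"

lemma circle_integrable:
  fixes F :: "complex \<Rightarrow> 'a::banach"
  assumes "continuous_on (sphere 0 r) F" "0 \<le> r"
  shows "(\<lambda>\<theta>. F (of_real r * cis \<theta>)) integrable_on {0..2 * pi}"
proof (rule integrable_continuous_interval)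
  show "continuous_on {0..2 * pi} (\<lambda>\<theta>. F (of_real r * cis \<theta>))"
    using assms(2) by (intro continuous_on_compose2[OF assms(1)] continuous_intros) (auto simp: norm_mult)
qed

lemma circle_mean_mono:
  assumes "continuous_on (sphere 0 r) F" "continuous_on (sphere 0 r) G" "0 \<le> r"
    and "\<And>z. norm z = r \<Longrightarrow> F z \<le> G z"
  shows "circle_mean F r \<le> circle_mean G r"
  unfolding circle_mean_def using assms
  by (intro mult_left_mono integral_le circle_integrable) (auto simp: norm_mult)

lemma circle_mean_cong:
  assumes "0 \<le> r" "\<And>z. norm z = r \<Longrightarrow> F z = G z"
  shows "circle_mean F r = circle_mean G r"
  unfolding circle_mean_def using assms
  by (intro arg_cong2[where f = "(*)"] refl integral_cong) (auto simp: norm_mult)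

lemma circle_mean_add:
  assumes "continuous_on (sphere 0 r) F" "continuous_on (sphere 0 r) G" "0 \<le> r"
  shows "circle_mean (\<lambda>z. F z + G z) r = circle_mean F r + circle_mean G r"
  unfolding circle_mean_def
  using integral_add[OF circle_integrable[OF assms(1,3)] circle_integrable[OF assms(2,3)]]
  by (simp add: algebra_simps add_divide_distrib)

lemma circle_mean_cmult: "circle_mean (\<lambda>z. c * F z) r = c * circle_mean F r"
  by (simp add: circle_mean_def)

lemma circle_mean_const: "circle_mean (\<lambda>_. c) r = c"
  by (simp add: circle_mean_def)

lemma circle_mean_nonneg:
  assumes "continuous_on (sphere 0 r) F" "0 \<le> r" "\<And>z. norm z = r \<Longrightarrow> 0 \<le> F z"
  shows "0 \<le> circle_mean F r"
  using circle_mean_mono[of r "\<lambda>_. 0" F] assms by (simp add: circle_mean_const)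

lemma circle_mean_tendsto:
  assumes "uniform_limit (sphere 0 r) F G sequentially" "\<And>n. continuous_on (sphere 0 r) (F n)" "0 \<le> r"
  shows "(\<lambda>n. circle_mean (F n) r) \<longlonglongrightarrow> circle_mean G r"
proof -
  let ?c = "\<lambda>\<theta>. of_real r * cis \<theta>"
  have u: "uniform_limit {0..2 * pi} (\<lambda>n \<theta>. F n (?c \<theta>)) (\<lambda>\<theta>. G (?c \<theta>)) sequentially"
    using assms(1,3) unfolding uniform_limit_iff by (auto simp: norm_mult elim!: eventually_mono)
  have c: "continuous_on {0..2 * pi} (\<lambda>\<theta>. F n (?c \<theta>))" for n
    using assms(3) by (intro continuous_on_compose2[OF assms(2)] continuous_intros) (auto simp: norm_mult)
  obtain I J where I: "\<And>n. ((\<lambda>\<theta>. F n (?c \<theta>)) has_integral I n) {0..2 * pi}"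
    and J: "((\<lambda>\<theta>. G (?c \<theta>)) has_integral J) {0..2 * pi}" and lim: "I \<longlonglongrightarrow> J"
    using uniform_limit_integral[OF u c sequentially_bot] by metis
  show ?thesis
    unfolding circle_mean_def integral_unique[OF I] integral_unique[OF J]
    by (intro tendsto_intros lim)
qed

text \<open>Orthogonality of distinct monomials on a circle, in the form of the cross term in the
  expansion of a squared modulus. On the circle the product is a constant times
  \<open>cis (- k * \<theta>)\<close> with \<open>k\<close> a nonzero integer, which has a periodic
  primitive.\<close>

lemma circle_mean_Re_cross:
  assumes "m < n"
  shows "circle_mean (\<lambda>z. Re (c * z ^ m * cnj (d * z ^ n))) r = 0"
proof -
  define k where "k = real n - real m"
  define B where "B = c * cnj d * of_real (r ^ (m + n))"
  have k: "k > 0" using assms by (simp add: k_def)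
  have eq: "c * (of_real r * cis \<theta>) ^ m * cnj (d * (of_real r * cis \<theta>) ^ n) = B * cis (- k * \<theta>)" for \<theta>
    by (simp add: B_def k_def power_mult_distrib power_add cis_cnj Complex.DeMoivre cis_mult algebra_simps
        flip: cis_divide)
  have "((\<lambda>\<theta>. Re (B * cis (- k * \<theta>))) has_integral
      Re (B * cis (- k * (2 * pi)) / (- \<i> * k)) - Re (B * cis (- k * 0) / (- \<i> * k))) {0..2 * pi}"
  proof (rule fundamental_theorem_of_calculus)
    fix \<theta> :: real
    have "((\<lambda>z. B * exp (\<i> * (- of_real k * z)) / (- \<i> * of_real k)) has_field_derivative
        B * exp (\<i> * (- of_real k * of_real \<theta>))) (at (of_real \<theta>))"
      using k by (auto intro!: derivative_eq_intros simp: field_simps)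
    from has_vector_derivative_real_field[OF this, of UNIV]
    have "((\<lambda>\<theta>. B * cis (- k * \<theta>) / (- \<i> * k)) has_vector_derivative B * cis (- k * \<theta>)) (at \<theta>)"
      by (simp add: cis_conv_exp)
    then show "((\<lambda>\<theta>. Re (B * cis (- k * \<theta>) / (- \<i> * k))) has_vector_derivative Re (B * cis (- k * \<theta>))) (at \<theta> within {0..2 * pi})"
      by (rule has_vector_derivative_at_within[OF bounded_linear.has_vector_derivative[OF bounded_linear_Re]])
  qed simp
  moreover have "cis (- k * (2 * pi)) = 1"
    using cis_multiple_2pi[of "- k"] by (simp add: k_def mult.commute)
  ultimately have "((\<lambda>\<theta>. Re (B * cis (- k * \<theta>))) has_integral 0) {0..2 * pi}"
    by simp
  then show ?thesis
    unfolding circle_mean_def eq by (simp add: integral_unique)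
qed

text \<open>Induction on the number of terms: the cross terms of the new monomial with all lower
  ones have mean zero.\<close>

lemma circle_mean_norm_sq_poly:
  assumes "0 \<le> r"
  shows "circle_mean (\<lambda>z. (norm (\<Sum>n<N. c n * z ^ n))\<^sup>2) r = (\<Sum>n<N. (norm (c n))\<^sup>2 * r ^ (2 * n))"
proof (induction N)
  case 0
  then show ?case by (simp add: circle_mean_const)
next
  case (Suc N)
  let ?S = "\<lambda>z. \<Sum>n<N. c n * z ^ n"
  have "circle_mean (\<lambda>z. (norm (\<Sum>n<Suc N. c n * z ^ n))\<^sup>2) r =
      circle_mean (\<lambda>z. (norm (?S z))\<^sup>2 + (2 * (\<Sum>n<N. Re (c n * z ^ n * cnj (c N * z ^ N))) + (norm (c N))\<^sup>2 * r ^ (2 * N))) r"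
  proof (rule circle_mean_cong[OF assms])
    fix z :: complex assume "norm z = r"
    have "(norm (x + y))\<^sup>2 = (norm x)\<^sup>2 + (2 * Re (x * cnj y) + (norm y)\<^sup>2)" for x y :: complex
      by (simp add: cmod_power2) (simp add: power2_eq_square algebra_simps)
    from this[of "?S z" "c N * z ^ N"] \<open>norm z = r\<close>
    show "(norm (\<Sum>n<Suc N. c n * z ^ n))\<^sup>2 = (norm (?S z))\<^sup>2 +
        (2 * (\<Sum>n<N. Re (c n * z ^ n * cnj (c N * z ^ N))) + (norm (c N))\<^sup>2 * r ^ (2 * N))"
      unfolding sum.lessThan_Suc sum_distrib_right Re_sum
      by (simp add: norm_mult norm_power power_mult_distrib power_even_eq)
  qed
  also have "\<dots> = circle_mean (\<lambda>z. (norm (?S z))\<^sup>2) r +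
      (2 * circle_mean (\<lambda>z. \<Sum>n<N. Re (c n * z ^ n * cnj (c N * z ^ N))) r + (norm (c N))\<^sup>2 * r ^ (2 * N))"
    by (subst circle_mean_add, (intro continuous_intros assms)+)+
      (simp add: circle_mean_cmult circle_mean_const)
  also have "circle_mean (\<lambda>z. \<Sum>n<N. Re (c n * z ^ n * cnj (c N * z ^ N))) r =
      (\<Sum>n<N. circle_mean (\<lambda>z. Re (c n * z ^ n * cnj (c N * z ^ N))) r)"
    unfolding circle_mean_def sum_distrib_left[symmetric]
    by (rule arg_cong[OF integral_sum], simp,
        rule circle_integrable[where F = "\<lambda>z. Re (c n * z ^ n * cnj (c N * z ^ N))" for n], intro continuous_intros, rule assms)
  also have "\<dots> = 0"
    by (intro sum.neutral ballI circle_mean_Re_cross) auto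
  finally show ?case using Suc.IH by simp
qed

section \<open>Taylor coefficients at the origin and Parseval's identity\<close>

definition taylor :: "(complex \<Rightarrow> complex) \<Rightarrow> nat \<Rightarrow> complex" where
  "taylor h n = (deriv ^^ n) h 0 / fact n"

lemma taylor_sums:
  assumes "h holomorphic_on ball 0 R" "norm z < R"
  shows "(\<lambda>n. taylor h n * z ^ n) sums h z"
  using holomorphic_power_series[OF assms(1), of z] assms(2) by (simp add: taylor_def)

text \<open>A series converging to \<open>h\<close> near 0 is its formal power series expansion,
  whose coefficients are determined by the derivatives at 0. This identifies a given coefficient
  sequence, or the coefficients of a polynomial, with \<open>taylor\<close>.\<close>

lemma taylor_unique:
  assumes "0 < R" and c: "\<And>z. norm z < R \<Longrightarrow> (\<lambda>n. c n * z ^ n) sums h z"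
  shows "taylor h = c"
proof
  fix n
  have "ereal R \<le> fps_conv_radius (Abs_fps c)"
    unfolding fps_conv_radius_def
  proof (rule conv_radius_geI_ex')
    fix r assume "0 < r" "ereal r < ereal R"
    then show "summable (\<lambda>n. fps_nth (Abs_fps c) n * of_real r ^ n)"
      using c[of "of_real r"] by (auto simp: sums_iff)
  qed
  moreover have "eventually (\<lambda>z. eval_fps (Abs_fps c) z = h z) (nhds 0)"
    using eventually_nhds_in_open[of "ball 0 R" "0 :: complex"] assms(1)
    by (auto elim!: eventually_mono simp: eval_fps_def dest!: c simp: sums_iff)
  ultimately have "h has_fps_expansion Abs_fps c"
    unfolding has_fps_expansion_def using assms(1)
    by (auto intro: less_le_trans[of _ "ereal R"])
  from fps_nth_fps_expansion[OF this, of n] show "taylor h n = c n"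
    by (simp add: taylor_def)
qed

lemma taylor_deriv: "taylor (deriv h) n = of_nat (Suc n) * taylor h (Suc n)"
  by (simp add: taylor_def funpow_swap1 field_simps del: of_nat_Suc)

lemma taylor_mult:
  assumes "g holomorphic_on ball 0 R" "h holomorphic_on ball 0 R" "0 < R"
  shows "taylor (\<lambda>z. g z * h z) n = (\<Sum>i\<le>n. taylor g i * taylor h (n - i))"
  unfolding taylor_def using assms
  by (subst higher_deriv_mult[of _ "ball 0 R"])
    (auto simp: sum_divide_distrib binomial_fact atLeast0AtMost intro!: sum.cong)

lemma taylor_uniform_limit:
  assumes "h holomorphic_on ball 0 R" "0 \<le> r" "r < R"
  shows "uniform_limit (cball 0 r) (\<lambda>N z. \<Sum>n<N. taylor h n * z ^ n) h sequentially"
proof -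
  obtain t where t: "r < t" "t < R" using assms(3) dense by blast
  define x :: complex where "x = of_real t"
  have x: "r < norm x" "norm x < R" using assms t by (simp_all add: x_def)
  have "ereal r < ereal (norm x)" using x by simp
  also have "\<dots> \<le> conv_radius (taylor h)"
    by (rule conv_radius_geI[OF sums_summable[OF taylor_sums[OF assms(1) x(2)]]])
  finally have "uniform_limit (cball 0 r) (\<lambda>N z. \<Sum>n<N. taylor h n * (z - 0) ^ n) (\<lambda>z. \<Sum>n. taylor h n * (z - 0) ^ n) sequentially"
    by (rule powser_uniform_limit)
  then show ?thesis
    using assms taylor_sums[OF assms(1)] by (subst uniform_limit_cong'[where g = "\<lambda>N z. \<Sum>n<N. taylor h n * (z - 0) ^ n" and i = "\<lambda>z. \<Sum>n. taylor h n * (z - 0) ^ n"]) (auto simp: sums_iff)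
qed

text \<open>The polynomial case passes to the limit because the partial sums converge uniformly on
  the circle and \<open>h\<close> is bounded there.\<close>

lemma parseval_circle:
  assumes h: "h holomorphic_on ball 0 R" and r: "0 \<le> r" "r < R"
  shows "(\<lambda>n. (norm (taylor h n))\<^sup>2 * r ^ (2 * n)) sums circle_mean (\<lambda>z. (norm (h z))\<^sup>2) r"
proof -
  let ?S = "\<lambda>N z. \<Sum>n<N. taylor h n * z ^ n"
  have u: "uniform_limit (cball 0 r) ?S h sequentially"
    by (rule taylor_uniform_limit[OF h r])
  have ch: "continuous_on (cball 0 r) h"
    using r by (intro holomorphic_on_imp_continuous_on holomorphic_on_subset[OF h]) auto
  have "uniform_limit (sphere 0 r) (\<lambda>N z. (norm (?S N z))\<^sup>2) (\<lambda>z. (norm (h z))\<^sup>2) sequentially"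
    unfolding power2_eq_square
  proof (intro uniform_lim_mult uniform_limit_norm uniform_limit_on_subset[OF u])
    show "bounded ((\<lambda>z. norm (h z)) ` sphere 0 r)"
      using r by (intro compact_imp_bounded compact_continuous_image continuous_intros continuous_on_subset[OF ch]) auto
    then show "bounded ((\<lambda>z. norm (h z)) ` sphere 0 r)" .
  qed auto
  moreover have "continuous_on (sphere 0 r) (\<lambda>z. (norm (?S N z))\<^sup>2)" for N
    by (intro continuous_intros)
  ultimately show ?thesis
    using circle_mean_tendsto[OF _ _ r(1)] unfolding sums_def circle_mean_norm_sq_poly[OF r(1), symmetric]
    by blast
qed

section \<open>Taylor coefficients of powers of zero-free functions\<close>

text \<open>Induction on the degree, one linear factor at a time. A factor
  \<open>z - \<alpha>\<close> with \<alpha> outside the closed disc is kept; one with \<alpha>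
  inside is replaced by \<open>1 - cnj \<alpha> * z\<close>, which has the same modulus on the
  circle and its zero, if any, outside. This amounts to dividing by a finite Blaschke
  product.\<close>

lemma reflect_zeros:
  fixes P :: "complex poly"
  assumes "P \<noteq> 0" "\<And>z. norm z = 1 \<Longrightarrow> poly P z \<noteq> 0"
  obtains g R where "R > 1" "\<And>z. norm z < R \<Longrightarrow> poly g z \<noteq> 0"
    "\<And>z. norm z = 1 \<Longrightarrow> norm (poly g z) = norm (poly P z)"
proof -
  have "\<exists>g R. R > 1 \<and> (\<forall>z. norm z < R \<longrightarrow> poly g z \<noteq> 0) \<and>
      (\<forall>z. norm z = 1 \<longrightarrow> norm (poly g z) = norm (poly P z))"
    using assms
  proof (induction "degree P" arbitrary: P)
    case 0
    then obtain c where "P = [:c:]" by (metis degree_eq_zeroE)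
    with 0 have "\<forall>z. poly P z \<noteq> 0" by simp
    then show ?case by (intro exI[of _ P] exI[of _ "2 :: real"]) auto
  next
    case (Suc n)
    have "\<not> constant (poly P)"
      using Suc.hyps(2) Fundamental_Theorem_Algebra.constant_degree[of P] by simp
    then obtain \<alpha> where "poly P \<alpha> = 0"
      using Fundamental_Theorem_Algebra.fundamental_theorem_of_algebra by blast
    then obtain Q where PQ: "P = [:-\<alpha>, 1:] * Q"
      by (metis dvdE poly_eq_0_iff_dvd)
    have Q: "Q \<noteq> 0" "\<And>z. norm z = 1 \<Longrightarrow> poly Q z \<noteq> 0"
      using Suc.prems unfolding PQ by auto
    have "n = degree Q"
      using Suc.hyps(2) Q(1) unfolding PQ by (subst (asm) degree_mult_eq) auto
    from Suc.hyps(1)[OF this Q] obtain g R where g: "R > 1" "\<And>z. norm z < R \<Longrightarrow> poly g z \<noteq> 0"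
      "\<And>z. norm z = 1 \<Longrightarrow> norm (poly g z) = norm (poly Q z)" by blast
    have "norm \<alpha> \<noteq> 1"
      using Suc.prems(2)[of \<alpha>] \<open>poly P \<alpha> = 0\<close> by blast
    then consider "norm \<alpha> > 1" | "norm \<alpha> < 1" by linarith
    then show ?case
    proof cases
      case 1
      have "poly ([:-\<alpha>, 1:] * g) z \<noteq> 0" if "norm z < min R (norm \<alpha>)" for z
        using that g(2)[of z] by auto
      then show ?thesis
        using 1 g unfolding PQ
        by (intro exI[of _ "[:-\<alpha>, 1:] * g"] exI[of _ "min R (norm \<alpha>)"]) (auto simp: norm_mult simp del: mult_pCons_left)
    next
      case 2
      \<comment> \<open>This radius exceeds 1 and satisfies \<open>norm \<alpha> * ?r < 1\<close>;
        unlike \<open>1 / norm \<alpha>\<close> it also works for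
        \<open>\<alpha> = 0\<close>.\<close>
      let ?r = "2 / (1 + norm \<alpha>)"
      have ineq: "norm (cnj \<alpha> * z) < 1" if "norm z < ?r" for z
      proof -
        have "norm (cnj \<alpha> * z) \<le> norm \<alpha> * ?r"
          using that by (simp only: norm_mult complex_mod_cnj) (intro mult_left_mono, auto)
        also have "\<dots> < 1" using 2 by (simp add: divide_simps add_pos_nonneg)
        finally show ?thesis .
      qed
      have "poly ([:1, - cnj \<alpha>:] * g) z \<noteq> 0" if "norm z < min R ?r" for z
      proof -
        have "cnj \<alpha> * z \<noteq> 1" using ineq[of z] that by auto
        then show ?thesis using g(2)[of z] that by (auto simp: mult.commute)
      qed
      moreover have "norm (1 - cnj \<alpha> * z) = norm (z - \<alpha>)" if "norm z = 1" for z
      proof -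
        have "z * cnj z = 1"
          using that by (simp add: complex_norm_square[symmetric])
        then have "1 - cnj \<alpha> * z = z * cnj (z - \<alpha>)" by (simp add: algebra_simps)
        then show ?thesis using that by (simp add: norm_mult del: complex_cnj_diff)
      qed
      ultimately show ?thesis
        using 2 g unfolding PQ
        by (intro exI[of _ "[:1, - cnj \<alpha>:] * g"] exI[of _ "min R ?r"])
          (auto simp: norm_mult divide_simps add_pos_nonneg mult.commute add.commute simp del: mult_pCons_left mult_pCons_right)
    qed
  qed
  then show ?thesis using that by blast
qed

text \<open>Cauchy-Schwarz for the Taylor series: the squared coefficients sum to the mean on the
  unit circle by Parseval, and the squared powers of \<open>norm z\<close> form a geometric
  series.\<close>

lemma norm_sq_growth:
  assumes h: "h holomorphic_on ball 0 R" "1 < R" and z: "norm z < 1"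
  shows "(norm (h z))\<^sup>2 \<le> circle_mean (\<lambda>w. (norm (h w))\<^sup>2) 1 / (1 - (norm z)\<^sup>2)"
proof -
  let ?M = "circle_mean (\<lambda>w. (norm (h w))\<^sup>2) 1"
  have M: "(\<lambda>n. (norm (taylor h n))\<^sup>2) sums ?M"
    using parseval_circle[OF h(1), of 1] h(2) by simp
  have "(norm z)\<^sup>2 < 1" using z by (simp add: power_less_one_iff abs_square_less_1)
  then have G: "(\<lambda>n. ((norm z)\<^sup>2) ^ n) sums (1 / (1 - (norm z)\<^sup>2))"
    by (intro geometric_sums) simp
  have "(\<lambda>N. (norm (\<Sum>n<N. taylor h n * z ^ n))\<^sup>2) \<longlonglongrightarrow> (norm (h z))\<^sup>2"
    using taylor_sums[OF h(1), of z] h(2) z unfolding sums_def by (intro tendsto_intros) auto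
  moreover have "(norm (\<Sum>n<N. taylor h n * z ^ n))\<^sup>2 \<le> ?M * (1 / (1 - (norm z)\<^sup>2))" for N
  proof -
    have "(norm (\<Sum>n<N. taylor h n * z ^ n))\<^sup>2 \<le> (\<Sum>n<N. norm (taylor h n) * norm z ^ n)\<^sup>2"
      by (intro power_mono sum_norm_le) (auto simp: norm_mult norm_power)
    also have "\<dots> \<le> (\<Sum>n<N. (norm (taylor h n))\<^sup>2) * (\<Sum>n<N. (norm z ^ n)\<^sup>2)"
      by (rule Cauchy_Schwarz_ineq_sum)
    also have "(\<Sum>n<N. (norm z ^ n)\<^sup>2) = (\<Sum>n<N. ((norm z)\<^sup>2) ^ n)"
      by (simp add: power_mult[symmetric] mult.commute)
    also have "(\<Sum>n<N. (norm (taylor h n))\<^sup>2) * (\<Sum>n<N. ((norm z)\<^sup>2) ^ n) \<le> ?M * (1 / (1 - (norm z)\<^sup>2))"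
      using sum_le_suminf[OF sums_summable[OF M], of "{..<N}"] sum_le_suminf[OF sums_summable[OF G], of "{..<N}"]
      by (intro mult_mono) (auto simp: sums_unique[OF M, symmetric] sums_unique[OF G, symmetric] intro!: sum_nonneg circle_mean_nonneg
        continuous_intros holomorphic_on_imp_continuous_on holomorphic_on_subset[OF h(1)] simp: h(2))
    finally show ?thesis .
  qed
  ultimately show ?thesis
    by (intro LIMSEQ_le_const2) auto
qed

text \<open>A beta integral of order \<open>(j + 1) powr (- a - 1)\<close>. With
  \<open>d = 1 / (4 * (j + 1))\<close>, the interval from \<open>1 - 2 * d\<close> to
  \<open>1 - d\<close> already gives the bound: there \<open>x ^ j\<close> is at least 1/2 by
  Bernoulli's inequality and \<open>1 - x\<close> is at least \<open>d\<close>.\<close>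

lemma beta_integral_lower:
  fixes a :: real and j :: nat
  assumes "0 < a"
  shows "(4 * real (j + 1)) powr (- a - 1) / 2 \<le> integral {0..1} (\<lambda>x. x ^ j * (1 - x) powr a)"
proof -
  define d where "d = 1 / (4 * real (j + 1))"
  have d: "0 < d" "2 * d \<le> 1" by (auto simp: d_def divide_simps)
  have cont: "continuous_on S (\<lambda>x. x ^ j * (1 - x) powr a)" if "S \<subseteq> {0..1}" for S :: "real set"
    using assms that by (intro continuous_intros continuous_on_powr') auto
  have "(d powr a / 2) * d = integral {1 - 2 * d..1 - d} (\<lambda>x. d powr a / 2)"
    using d by simp
  also have "\<dots> \<le> integral {1 - 2 * d..1 - d} (\<lambda>x. x ^ j * (1 - x) powr a)"
  proof (intro integral_le integrable_const_ivl integrable_continuous_interval cont)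
    fix x assume x: "x \<in> {1 - 2 * d..1 - d}"
    have "1 / 2 \<le> 1 + real j * (- (2 * d))"
      by (simp add: d_def field_simps)
    also have "\<dots> \<le> (1 + (- (2 * d))) ^ j"
      using d by (intro Bernoulli_inequality) auto
    also have "\<dots> \<le> x ^ j" using x d by (intro power_mono) auto
    finally have "1 / 2 \<le> x ^ j" .
    moreover have "d powr a \<le> (1 - x) powr a"
      using x d assms by (intro powr_mono2) auto
    ultimately have "(1 / 2) * d powr a \<le> x ^ j * (1 - x) powr a"
      by (intro mult_mono) (use x d in auto)
    then show "d powr a / 2 \<le> x ^ j * (1 - x) powr a" by simp
  qed (use d in auto)
  also have "\<dots> \<le> integral {0..1} (\<lambda>x. x ^ j * (1 - x) powr a)"
    using d by (intro integral_subset_le integrable_continuous_interval cont) auto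
  also have "(d powr a / 2) * d = (4 * real (j + 1)) powr (- a - 1) / 2"
    by (simp add: d_def powr_divide powr_minus_divide powr_diff field_simps)
  finally show ?thesis .
qed

text \<open>With \<open>u = exp L\<close>, the coefficients are those of
  \<open>v = u powr (1 + 2 * s)\<close>; working with the logarithm \<open>L\<close> makes this
  power holomorphic. The weighted square sum is controlled by an integral over the radii of the
  means of the squared modulus of \<open>v'\<close>, and \<open>v'\<close> is \<open>u'\<close>
  times a power of \<open>u\<close>, to which the growth bound applies.\<close>

lemma exp_power_coeff_bound:
  fixes s :: real and L :: "complex \<Rightarrow> complex"
  assumes L: "L holomorphic_on ball 0 R" "1 < R" and s: "0 \<le> s"
  defines "M \<equiv> circle_mean (\<lambda>z. (norm (exp (L z)))\<^sup>2) 1"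
  shows "(\<Sum>j<N. real (j + 1) powr (- 2 * s) * (norm (taylor (\<lambda>z. exp ((1 + 2 * s) * L z)) j))\<^sup>2) \<le>
     (1 + 2 * (1 + 2 * s)\<^sup>2 * 4 powr (2 * s + 2)) * M powr (1 + 2 * s)"
proof -
  define u v where "u = (\<lambda>z. exp (L z))" and "v = (\<lambda>z. exp ((1 + 2 * s) * L z))"
  define \<kappa> where "\<kappa> = 1 + 2 * s"
  \<comment> \<open>\<open>V\<close> and \<open>U\<close> are the squared moduli of the Taylor
    coefficients of \<open>v'\<close> and \<open>u'\<close>.\<close>
  define V U where "V = (\<lambda>j. (real (j + 1))\<^sup>2 * (norm (taylor v (Suc j)))\<^sup>2)"
    and "U = (\<lambda>j. (real (j + 1))\<^sup>2 * (norm (taylor u (Suc j)))\<^sup>2)"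
  have u: "u holomorphic_on ball 0 R" and v: "v holomorphic_on ball 0 R"
    unfolding u_def v_def using L(1) by (auto intro!: holomorphic_intros)
  have du: "deriv u holomorphic_on ball 0 R" and dv: "deriv v holomorphic_on ball 0 R"
    using u v by (auto intro!: holomorphic_deriv)
  have cont: "continuous_on (sphere 0 r) h" if "h holomorphic_on ball 0 R" "r < R" for h r
    using that by (intro holomorphic_on_imp_continuous_on holomorphic_on_subset[OF that(1)]) auto
  have norm_v: "(norm (v z))\<^sup>2 = (norm (u z))\<^sup>2 * ((norm (u z))\<^sup>2) powr (2 * s)" for z
  proof -
    have "(norm (u z))\<^sup>2 = exp (2 * Re (L z))"
      by (simp add: u_def exp_double)
    moreover have "(norm (v z))\<^sup>2 = exp (2 * ((1 + 2 * s) * Re (L z)))"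
      by (simp only: exp_double) (simp add: v_def)
    ultimately show ?thesis
      by (simp add: powr_def exp_add[symmetric] algebra_simps)
  qed
  have Msum: "(\<lambda>n. (norm (taylor u n))\<^sup>2) sums M"
    using parseval_circle[OF u, of 1] L(2) by (simp add: M_def u_def)
  have M: "0 < M"
  proof -
    have "(norm (taylor u 0))\<^sup>2 \<le> M"
      using sums_le[of "\<lambda>n. if n = 0 then (norm (taylor u n))\<^sup>2 else 0", OF _ sums_single Msum] by simp
    moreover have "0 < (norm (taylor u 0))\<^sup>2"
      by (simp add: taylor_def u_def)
    ultimately show ?thesis by linarith
  qed
  have deriv_sums: "(\<lambda>j. (real (j + 1))\<^sup>2 * (norm (taylor h (Suc j)))\<^sup>2 * r ^ (2 * j)) sums
      circle_mean (\<lambda>z. (norm (deriv h z))\<^sup>2) r"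
    if "h holomorphic_on ball 0 R" "0 \<le> r" "r < R" for h r
    using parseval_circle[OF holomorphic_deriv[OF that(1)] that(2,3)]
    by (simp add: taylor_deriv norm_mult power_mult_distrib del: of_nat_Suc)
  have Usum: "U sums circle_mean (\<lambda>z. (norm (deriv u z))\<^sup>2) 1"
    using deriv_sums[OF u, of 1] L(2) by (simp add: U_def)
  txt \<open>With \<open>x = \<rho>\<^sup>2\<close> this compares the means of \<open>\<bar>v'\<bar>\<^sup>2\<close> and \<open>\<bar>u'\<bar>\<^sup>2\<close> on the circle of radius \<open>\<rho>\<close>; integrating
    it against \<open>(1 - x) powr (2 * s + 1)\<close> gives the claim without a logarithmic loss.\<close>
  have key: "(\<Sum>j<N. V j * x ^ j) \<le> \<kappa>\<^sup>2 * (M / (1 - x)) powr (2 * s) * (\<Sum>j. U j * x ^ j)"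
    if x: "0 \<le> x" "x < 1" for x :: real and N
  proof -
    define \<rho> where "\<rho> = sqrt x"
    have \<rho>: "0 \<le> \<rho>" "\<rho> < 1" "\<rho>\<^sup>2 = x" "\<rho> < R" using x L(2) by (auto simp: \<rho>_def intro: less_trans[of _ 1])
    have pw: "\<rho> ^ (2 * j) = x ^ j" for j using \<rho>(3) by (simp add: power_mult)
    have sv: "(\<lambda>j. V j * x ^ j) sums circle_mean (\<lambda>z. (norm (deriv v z))\<^sup>2) \<rho>"
      using deriv_sums[OF v \<rho>(1,4)] by (simp add: V_def pw)
    have su: "(\<lambda>j. U j * x ^ j) sums circle_mean (\<lambda>z. (norm (deriv u z))\<^sup>2) \<rho>"
      using deriv_sums[OF u \<rho>(1,4)] by (simp add: U_def pw)
    have "(\<Sum>j<N. V j * x ^ j) \<le> circle_mean (\<lambda>z. (norm (deriv v z))\<^sup>2) \<rho>"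
      using sum_le_suminf[OF sums_summable[OF sv], of "{..<N}"] x sums_unique[OF sv]
      by (auto simp: V_def)
    also have "\<dots> \<le> circle_mean (\<lambda>z. \<kappa>\<^sup>2 * (M / (1 - x)) powr (2 * s) * (norm (deriv u z))\<^sup>2) \<rho>"
    proof (rule circle_mean_mono)
      fix z :: complex assume z: "norm z = \<rho>"
      have "(L has_field_derivative deriv L z) (at z)"
        using z \<rho>(4) by (intro holomorphic_derivI[OF L(1)]) auto
      then have "deriv u z = deriv L z * u z" "deriv v z = \<kappa> * deriv L z * v z"
        unfolding u_def v_def \<kappa>_def by (auto intro!: DERIV_imp_deriv derivative_eq_intros)
      then have "(norm (deriv v z))\<^sup>2 = \<kappa>\<^sup>2 * ((norm (u z))\<^sup>2) powr (2 * s) * (norm (deriv u z))\<^sup>2"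
        using norm_v[of z] by (simp add: norm_mult power_mult_distrib mult_ac)
      also have "\<dots> \<le> \<kappa>\<^sup>2 * (M / (1 - x)) powr (2 * s) * (norm (deriv u z))\<^sup>2"
        using norm_sq_growth[OF u L(2), of z] z \<rho> s
        by (intro mult_right_mono mult_left_mono powr_mono2) (auto simp: M_def u_def)
      finally show "(norm (deriv v z))\<^sup>2 \<le> \<kappa>\<^sup>2 * (M / (1 - x)) powr (2 * s) * (norm (deriv u z))\<^sup>2" .
    qed (use \<rho> du dv cont in \<open>auto intro!: continuous_intros\<close>)
    also have "\<dots> = \<kappa>\<^sup>2 * (M / (1 - x)) powr (2 * s) * (\<Sum>j. U j * x ^ j)"
      by (simp add: circle_mean_cmult sums_unique[OF su])
    finally show ?thesis .
  qed
  define I where "I = (\<lambda>j. integral {0..1} (\<lambda>x. x ^ j * (1 - x) powr (2 * s + 1)))"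
  have contI: "continuous_on {0..1} (\<lambda>x. x ^ j * (1 - x) powr (2 * s + 1))" for j :: nat
    using s by (intro continuous_intros continuous_on_powr') auto
  have VI: "(\<Sum>j<N. V j * I j) \<le> \<kappa>\<^sup>2 * M powr (2 * s) * M" for N
  proof (rule LIMSEQ_le_const)
    \<comment> \<open>The tail of the series of \<open>U\<close>, which converges since
      \<open>u\<close> is holomorphic beyond the closed disc. Splitting it off leaves only finite
      sums to integrate, and it tends to 0.\<close>
    define T where "T = (\<lambda>m. (\<Sum>j. U (j + m)))"
    have T: "T \<longlonglongrightarrow> 0"
      unfolding T_def using suminf_exist_split2[OF sums_summable[OF Usum]] by simp
    then show "(\<lambda>m. \<kappa>\<^sup>2 * M powr (2 * s) * (M + T m)) \<longlonglongrightarrow> \<kappa>\<^sup>2 * M powr (2 * s) * M"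
      by (auto intro!: tendsto_eq_intros)
    have "(\<Sum>j<N. V j * I j) \<le> \<kappa>\<^sup>2 * M powr (2 * s) * (M + T m)" for m
    proof -
      have U0: "0 \<le> U j" for j by (simp add: U_def)
      have "(\<Sum>j<N. V j * I j) = integral {0..1} (\<lambda>x. \<Sum>j<N. V j * (x ^ j * (1 - x) powr (2 * s + 1)))"
        unfolding I_def
        by (subst integral_sum) (simp_all add: integrable_continuous_interval continuous_on_mult_left contI)
      also have "\<dots> \<le> integral {0..1} (\<lambda>x. \<kappa>\<^sup>2 * M powr (2 * s) * ((\<Sum>j<m. U j * (x ^ j - x ^ Suc j)) + T m))"
      proof (intro integral_le integrable_continuous_interval continuous_on_sum continuous_on_mult_left
          contI continuous_on_add continuous_on_const continuous_on_diff continuous_on_power continuous_on_id)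
        fix x :: real assume x: "x \<in> {0..1}"
        show "(\<Sum>j<N. V j * (x ^ j * (1 - x) powr (2 * s + 1))) \<le>
            \<kappa>\<^sup>2 * M powr (2 * s) * ((\<Sum>j<m. U j * (x ^ j - x ^ Suc j)) + T m)"
        proof (cases "x = 1")
          \<comment> \<open>The bound \<open>key\<close> covers only \<open>x < 1\<close>. At
            \<open>x = 1\<close> the left side vanishes because the power of \<open>1 - x\<close> is
            0, and the right side is a nonnegative multiple of \<open>T m\<close>.\<close>
          case True
          then show ?thesis
            using M U0 summable_ignore_initial_segment[OF sums_summable[OF Usum], of m]
            by (auto simp: T_def intro!: mult_nonneg_nonneg suminf_nonneg)
        next
          case False
          with x have x: "0 \<le> x" "x < 1" by auto
          have le: "U j * x ^ j \<le> U j" for j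
            using x U0[of j] by (intro mult_left_le power_le_one) auto
          have sx: "summable (\<lambda>j. U j * x ^ j)"
            by (rule summable_comparison_test'[OF sums_summable[OF Usum], of 0]) (use le U0 x in auto)
          have "(\<Sum>j. U j * x ^ j) = (\<Sum>j<m. U j * x ^ j) + (\<Sum>j. U (j + m) * x ^ (j + m))"
            by (subst suminf_split_initial_segment[OF sx, of m]) simp
          also have "(\<Sum>j. U (j + m) * x ^ (j + m)) \<le> T m"
            unfolding T_def
            by (intro suminf_le le summable_ignore_initial_segment[OF sx]
                summable_ignore_initial_segment[OF sums_summable[OF Usum]])
          finally have "(1 - x) * (\<Sum>j. U j * x ^ j) \<le> (1 - x) * ((\<Sum>j<m. U j * x ^ j) + T m)"
            using x by (intro mult_left_mono) auto
          also have "\<dots> \<le> (\<Sum>j<m. U j * (x ^ j - x ^ Suc j)) + T m"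
          proof -
            have "0 \<le> T m"
              unfolding T_def using U0
              by (intro suminf_nonneg summable_ignore_initial_segment[OF sums_summable[OF Usum]]) auto
            then have "(1 - x) * T m \<le> T m" using x by (intro mult_left_le_one_le) auto
            then show ?thesis by (simp add: algebra_simps sum_distrib_left sum_subtractf)
          qed
          finally have le2: "(1 - x) * (\<Sum>j. U j * x ^ j) \<le> (\<Sum>j<m. U j * (x ^ j - x ^ Suc j)) + T m" .
          have "(\<Sum>j<N. V j * (x ^ j * (1 - x) powr (2 * s + 1))) =
              (1 - x) powr (2 * s + 1) * (\<Sum>j<N. V j * x ^ j)"
            unfolding sum_distrib_left by (intro sum.cong) simp_all
          also have "\<dots> \<le> (1 - x) powr (2 * s + 1) * (\<kappa>\<^sup>2 * (M / (1 - x)) powr (2 * s) * (\<Sum>j. U j * x ^ j))"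
            by (intro mult_left_mono key x) auto
          \<comment> \<open>The exponent \<open>2 * s + 1\<close> is chosen so that exactly one
            factor \<open>1 - x\<close> survives.\<close>
          also have "\<dots> = \<kappa>\<^sup>2 * M powr (2 * s) * ((1 - x) * (\<Sum>j. U j * x ^ j))"
            using x M by (simp add: powr_add powr_divide)
          also have "\<dots> \<le> \<kappa>\<^sup>2 * M powr (2 * s) * ((\<Sum>j<m. U j * (x ^ j - x ^ Suc j)) + T m)"
            by (intro mult_left_mono le2) auto
          finally show ?thesis .
        qed
      qed
      also have "\<dots> = \<kappa>\<^sup>2 * M powr (2 * s) * ((\<Sum>j<m. U j * (1 / real (j + 1) - 1 / real (j + 2))) + T m)"
      proof (rule integral_unique)
        have pw: "((\<lambda>x::real. x ^ j) has_integral 1 / real (j + 1)) {0..1}" for j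
        proof -
          have "((\<lambda>x. x ^ Suc j / real (Suc j)) has_real_derivative x ^ j) (at x within {0..1})" for x :: real
            using DERIV_cdivide[OF DERIV_pow[of "Suc j" x "{0..1}"], of "real (Suc j)"]
            by (simp del: power_Suc of_nat_Suc)
          then have "((\<lambda>x::real. x ^ j) has_integral 1 ^ Suc j / real (Suc j) - 0 ^ Suc j / real (Suc j)) {0..1}"
            by (intro fundamental_theorem_of_calculus)
              (simp_all flip: has_real_derivative_iff_has_vector_derivative)
          then show ?thesis by (simp add: add.commute)
        qed
        have "((\<lambda>x::real. x ^ j - x ^ Suc j) has_integral 1 / real (j + 1) - 1 / real (j + 2)) {0..1}" for j
          using has_integral_diff[OF pw[of j] pw[of "Suc j"]] by simp
        then show "((\<lambda>x. \<kappa>\<^sup>2 * M powr (2 * s) * ((\<Sum>j<m. U j * (x ^ j - x ^ Suc j)) + T m))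
          has_integral \<kappa>\<^sup>2 * M powr (2 * s) * ((\<Sum>j<m. U j * (1 / real (j + 1) - 1 / real (j + 2))) + T m)) {0..1}"
          using has_integral_const_real[of "T m" 0 1]
          by (intro has_integral_mult_right has_integral_add has_integral_sum) auto
      qed
      also have "\<dots> \<le> \<kappa>\<^sup>2 * M powr (2 * s) * (M + T m)"
      proof (intro mult_left_mono add_mono order_refl)
        \<comment> \<open>The integral of \<open>x ^ j - x ^ Suc j\<close> absorbs the square of
          \<open>j + 1\<close> in \<open>U\<close>, so that the coefficients of \<open>u'\<close>
          turn back into those of \<open>u\<close>, whose square sum is \<open>M\<close>.\<close>
        have "(\<Sum>j<m. U j * (1 / real (j + 1) - 1 / real (j + 2))) \<le> (\<Sum>j<m. (norm (taylor u (Suc j)))\<^sup>2)"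
        proof (rule sum_mono)
          fix j
          have "(real (j + 1))\<^sup>2 * (1 / real (j + 1) - 1 / real (j + 2)) = real (j + 1) / real (j + 2)"
            by (simp add: divide_simps power2_eq_square)
          also have "\<dots> \<le> 1" by simp
          finally have "(real (j + 1))\<^sup>2 * (1 / real (j + 1) - 1 / real (j + 2)) * (norm (taylor u (Suc j)))\<^sup>2
              \<le> 1 * (norm (taylor u (Suc j)))\<^sup>2"
            by (intro mult_right_mono) auto
          then show "U j * (1 / real (j + 1) - 1 / real (j + 2)) \<le> (norm (taylor u (Suc j)))\<^sup>2"
            by (simp add: U_def mult.assoc mult.commute[of "(norm _)\<^sup>2"])
        qed
        also have "\<dots> \<le> (\<Sum>j<Suc m. (norm (taylor u j))\<^sup>2)"
          unfolding sum.lessThan_Suc_shift by simp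
        also have "\<dots> \<le> M"
          using sum_le_suminf[OF sums_summable[OF Msum], of "{..<Suc m}"] sums_unique[OF Msum] by auto
        finally show "(\<Sum>j<m. U j * (1 / real (j + 1) - 1 / real (j + 2))) \<le> M" .
      qed auto
      finally show ?thesis .
    qed
    then show "\<exists>k. \<forall>m\<ge>k. (\<Sum>j<N. V j * I j) \<le> \<kappa>\<^sup>2 * M powr (2 * s) * (M + T m)" by blast
  qed
  \<comment> \<open>The beta integral with \<open>a = 2 * s + 1\<close> contributes the order
    \<open>n powr (- 2 * s - 2)\<close>, and the square of \<open>n\<close> in \<open>V\<close>
    restores the weight \<open>n powr (- 2 * s)\<close>. The weight belonging to index
    \<open>Suc j\<close> uses \<open>j + 2\<close> and is no larger.\<close>
  have tail: "real (j + 2) powr (- 2 * s) * (norm (taylor v (Suc j)))\<^sup>2 \<le> 2 * 4 powr (2 * s + 2) * (V j * I j)" for j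
  proof -
    define n where "n = real (j + 1)"
    have n: "n > 0" by (simp add: n_def)
    have "(4 * n) powr (- (2 * s + 2)) / 2 \<le> I j"
    proof -
      have eq: "- (2 * s + 2) = - (2 * s + 1) - 1" by simp
      show ?thesis
        unfolding I_def n_def eq using s by (intro beta_integral_lower) simp
    qed
    then have "V j * ((4 * n) powr (- (2 * s + 2)) / 2) \<le> V j * I j"
      by (intro mult_left_mono) (auto simp: V_def)
    then have "2 * 4 powr (2 * s + 2) * (V j * ((4 * n) powr (- (2 * s + 2)) / 2)) \<le> 2 * 4 powr (2 * s + 2) * (V j * I j)"
      by (rule mult_left_mono) auto
    also have "2 * 4 powr (2 * s + 2) * (V j * ((4 * n) powr (- (2 * s + 2)) / 2)) = n powr (- 2 * s) * (norm (taylor v (Suc j)))\<^sup>2"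
    proof -
      have "4 powr (2 * s + 2) * (4 * n) powr (- (2 * s + 2)) = n powr (- (2 * s + 2))"
        using n by (simp only: powr_mult powr_minus) simp
      moreover have "n\<^sup>2 * n powr (- (2 * s + 2)) = n powr (- 2 * s)"
        using n by (simp add: powr_add[symmetric] flip: powr_numeral)
      moreover have "2 * a * (n\<^sup>2 * w * (b / 2)) = n\<^sup>2 * (a * b) * w" for a b w :: real
        by simp
      ultimately show ?thesis
        unfolding V_def n_def[symmetric] by metis
    qed
    finally have "n powr (- 2 * s) * (norm (taylor v (Suc j)))\<^sup>2 \<le> 2 * 4 powr (2 * s + 2) * (V j * I j)" .
    moreover have "real (j + 2) powr (- 2 * s) \<le> n powr (- 2 * s)"
      using s by (intro powr_mono2') (auto simp: n_def)
    ultimately show ?thesis by (meson mult_right_mono order_trans zero_le_power2)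
  qed
  \<comment> \<open>The derivative does not see the constant coefficient, which is bounded
    separately by the growth bound at 0.\<close>
  have zero: "(norm (taylor v 0))\<^sup>2 \<le> M powr \<kappa>"
  proof -
    have "(norm (u 0))\<^sup>2 \<le> M"
      using norm_sq_growth[OF u L(2), of 0] by (simp add: M_def u_def)
    moreover have "(norm (v 0))\<^sup>2 = ((norm (u 0))\<^sup>2) powr \<kappa>"
      unfolding norm_v \<kappa>_def by (simp add: powr_add u_def)
    ultimately show ?thesis
      using s by (simp add: taylor_def \<kappa>_def powr_mono2)
  qed
  have "(\<Sum>j<N. real (j + 1) powr (- 2 * s) * (norm (taylor v j))\<^sup>2) \<le>
      (\<Sum>j<Suc N. real (j + 1) powr (- 2 * s) * (norm (taylor v j))\<^sup>2)"
    by simp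
  also have "\<dots> = (norm (taylor v 0))\<^sup>2 + (\<Sum>j<N. real (j + 2) powr (- 2 * s) * (norm (taylor v (Suc j)))\<^sup>2)"
    unfolding sum.lessThan_Suc_shift by simp
  also have "\<dots> \<le> M powr \<kappa> + (\<Sum>j<N. 2 * 4 powr (2 * s + 2) * (V j * I j))"
    by (intro add_mono zero sum_mono tail)
  also have "\<dots> \<le> M powr \<kappa> + 2 * 4 powr (2 * s + 2) * (\<kappa>\<^sup>2 * M powr (2 * s) * M)"
    unfolding sum_distrib_left[symmetric] by (intro add_mono mult_left_mono VI) auto
  also have "\<dots> = (1 + 2 * \<kappa>\<^sup>2 * 4 powr (2 * s + 2)) * M powr \<kappa>"
    using M by (simp add: \<kappa>_def powr_add algebra_simps)
  finally show ?thesis unfolding v_def \<kappa>_def .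
qed

section \<open>The weighted coefficient sum in Hardy spaces\<close>

text \<open>In the factorisation of \<open>P\<close> into \<phi> and \<open>v\<close>, both \<phi>
  and \<open>u\<close> have squared modulus \<open>norm (poly P z) powr q\<close> on the circle.
  Thus Parseval bounds the coefficients of \<phi>, \<open>exp_power_coeff_bound\<close> those of
  \<open>v\<close>, and Hilbert's inequality their Cauchy product.\<close>

lemma weighted_coeff_bound_poly:
  fixes P :: "complex poly" and q :: real
  assumes q: "0 < q" "q \<le> 1" and P: "\<And>z. norm z = 1 \<Longrightarrow> poly P z \<noteq> 0"
    and A: "circle_mean (\<lambda>z. norm (poly P z) powr q) 1 \<le> A"
  shows "(\<Sum>k<K. norm (coeff P k) * real (k + 1) powr (- 1 / q)) \<le>
    4 * A + 4 * ((1 + 2 * (2 / q - 1)\<^sup>2 * 4 powr (2 / q)) * A powr (2 / q - 1))"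
proof -
  \<comment> \<open>This \<open>s\<close> satisfies \<open>1 / q = 1 + s\<close>, which splits the
    weight into the Hilbert kernel and a power for \<open>v\<close>, and
    \<open>(1 + 2 * s) * (q / 2) = 1 - q / 2\<close>, which gives \<phi> the modulus of
    \<open>u\<close> on the circle.\<close>
  define s where "s = 1 / q - 1"
  have s: "0 \<le> s" "1 + 2 * s = 2 / q - 1" "2 * s + 2 = 2 / q" "- 1 / q = - 1 - s"
    using q by (auto simp: s_def)
  have "P \<noteq> 0" using P[of 1] by auto
  obtain g R where R: "1 < R" and g: "\<And>z. norm z < R \<Longrightarrow> poly g z \<noteq> 0"
    and gP: "\<And>z. norm z = 1 \<Longrightarrow> norm (poly g z) = norm (poly P z)"
    by (rule reflect_zeros[OF \<open>P \<noteq> 0\<close>], erule P, rule that) assumption+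
  have poly_hol: "poly p holomorphic_on S" for p :: "complex poly" and S
    by (meson poly_DERIV field_differentiable_def field_differentiable_at_within holomorphic_on_def)
  obtain L where L: "L holomorphic_on ball 0 R" "\<And>z. norm z < R \<Longrightarrow> exp (L z) = poly g z"
    using holomorphic_logarithm_exists[of "ball 0 R" "poly g" 0] poly_hol g R by auto
  \<comment> \<open>A holomorphic logarithm of the power of \<open>g\<close> with exponent
    \<open>q / 2\<close>.\<close>
  define L' where "L' = (\<lambda>z. of_real (q / 2) * L z)"
  have L': "L' holomorphic_on ball 0 R"
    unfolding L'_def by (intro holomorphic_intros L)
  define v where "v = (\<lambda>z. exp ((1 + 2 * s) * L' z))"
  \<comment> \<open>The quotient of \<open>P\<close> by \<open>v\<close>; it is holomorphic because
    \<open>v\<close> has no zeros, and it keeps all zeros of \<open>P\<close>.\<close>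
  define \<phi> where "\<phi> = (\<lambda>z. poly P z * exp (- ((1 + 2 * s) * L' z)))"
  define M where "M = circle_mean (\<lambda>z. (norm (exp (L' z)))\<^sup>2) 1"
  have norm_g: "norm (poly g z) = exp (Re (L z))" if "norm z = 1" for z
    using L(2)[of z] that R by (metis norm_exp_eq_Re)
  have "(norm (exp (L' z)))\<^sup>2 = norm (poly P z) powr q" if "norm z = 1" for z
    using norm_g[OF that] gP[OF that]
    by (simp add: L'_def powr_def exp_double[symmetric])
  then have M: "M = circle_mean (\<lambda>z. norm (poly P z) powr q) 1"
    unfolding M_def by (intro circle_mean_cong) auto
  have "(norm (\<phi> z))\<^sup>2 = norm (poly P z) powr q" if "norm z = 1" for z
  proof -
    have "norm (poly P z) = exp (Re (L z))" using norm_g[OF that] gP[OF that] by simp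
    then have "norm (\<phi> z) = exp (Re (L z) - (1 + 2 * s) * (q / 2) * Re (L z))"
      unfolding \<phi>_def L'_def norm_mult norm_exp_eq_Re by (simp flip: exp_add)
    also have "(1 + 2 * s) * (q / 2) = 1 - q / 2"
      unfolding s(2) using q by (simp add: field_simps)
    finally have "norm (\<phi> z) = exp (q / 2 * Re (L z))" by (simp add: algebra_simps)
    then show ?thesis
      using norm_g[OF that] gP[OF that] by (simp add: powr_def exp_double[symmetric])
  qed
  then have M\<phi>: "circle_mean (\<lambda>z. (norm (\<phi> z))\<^sup>2) 1 = M"
    unfolding M by (intro circle_mean_cong) auto
  have \<phi>: "\<phi> holomorphic_on ball 0 R" and v: "v holomorphic_on ball 0 R"
    unfolding \<phi>_def v_def by (intro holomorphic_intros L' poly_hol)+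
  have "M \<ge> 0"
    unfolding M_def using R
    by (intro circle_mean_nonneg continuous_intros holomorphic_on_imp_continuous_on holomorphic_on_subset[OF L']) auto
  have sum_\<phi>: "(\<Sum>i<K. (norm (taylor \<phi> i))\<^sup>2) \<le> A"
    using sum_le_suminf[of "\<lambda>i. (norm (taylor \<phi> i))\<^sup>2" "{..<K}"] parseval_circle[OF \<phi>, of 1] R M A
    by (auto simp: sums_iff M\<phi>)
  have "(\<Sum>j<K. (real (j + 1) powr (- s) * norm (taylor v j))\<^sup>2) =
      (\<Sum>j<K. real (j + 1) powr (- 2 * s) * (norm (taylor v j))\<^sup>2)"
    by (intro sum.cong refl) (simp add: power_mult_distrib power2_eq_square powr_add[symmetric])
  also have "\<dots> \<le> (1 + 2 * (1 + 2 * s)\<^sup>2 * 4 powr (2 * s + 2)) * M powr (1 + 2 * s)"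
    using exp_power_coeff_bound[OF L' R s(1), of K] unfolding v_def M_def .
  also have "\<dots> \<le> (1 + 2 * (1 + 2 * s)\<^sup>2 * 4 powr (2 * s + 2)) * A powr (1 + 2 * s)"
    using A s(1) \<open>M \<ge> 0\<close> M by (intro mult_left_mono powr_mono2) auto
  finally have sum_v: "(\<Sum>j<K. (real (j + 1) powr (- s) * norm (taylor v j))\<^sup>2) \<le>
      (1 + 2 * (1 + 2 * s)\<^sup>2 * 4 powr (2 * s + 2)) * A powr (1 + 2 * s)" .
  have P_eq: "poly P z = \<phi> z * v z" for z
    by (simp add: \<phi>_def v_def exp_minus)
  have "(\<lambda>k. coeff P k * z ^ k) sums (\<phi> z * v z)" for z
    using sums_finite[of "{..degree P}" "\<lambda>k. coeff P k * z ^ k"]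
    by (simp add: P_eq[symmetric] poly_altdef coeff_eq_0)
  then have coeff_P: "taylor (\<lambda>z. \<phi> z * v z) = coeff P"
    using R by (intro taylor_unique[of R]) auto
  define G where "G = (\<lambda>i j. norm (taylor \<phi> i) * norm (taylor v j) * real (i + j + 1) powr (- 1 / q))"
  have "(\<Sum>k<K. norm (coeff P k) * real (k + 1) powr (- 1 / q)) \<le> (\<Sum>k<K. \<Sum>i\<le>k. G i (k - i))"
  proof (rule sum_mono)
    fix k
    have "norm (coeff P k) \<le> (\<Sum>i\<le>k. norm (taylor \<phi> i) * norm (taylor v (k - i)))"
      using R taylor_mult[OF \<phi> v, of k]
      by (auto simp: coeff_P norm_mult[symmetric] intro!: norm_sum)
    then have "norm (coeff P k) * real (k + 1) powr (- 1 / q) \<le>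
        (\<Sum>i\<le>k. norm (taylor \<phi> i) * norm (taylor v (k - i))) * real (k + 1) powr (- 1 / q)"
      by (intro mult_right_mono) auto
    also have "\<dots> = (\<Sum>i\<le>k. G i (k - i))"
      by (simp add: G_def sum_distrib_right)
    finally show "norm (coeff P k) * real (k + 1) powr (- 1 / q) \<le> (\<Sum>i\<le>k. G i (k - i))" .
  qed
  also have "\<dots> = (\<Sum>(i, j)\<in>{(i, j). i + j < K}. G i j)"
    by (rule sum.triangle_reindex[symmetric])
  also have "\<dots> \<le> (\<Sum>(i, j)\<in>{..<K} \<times> {..<K}. G i j)"
    by (intro sum_mono2) (auto simp: G_def)
  also have "\<dots> = (\<Sum>i<K. \<Sum>j<K. G i j)"
    by (simp add: sum.cartesian_product)
  also have "\<dots> \<le> (\<Sum>i<K. \<Sum>j<K. norm (taylor \<phi> i) * (real (j + 1) powr (- s) * norm (taylor v j)) / real (i + j + 1))"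
  proof (intro sum_mono)
    fix i j
    \<comment> \<open>Since \<open>i + j + 1 \<ge> j + 1\<close>, the surplus power
      \<open>- s\<close> can be charged to \<open>j\<close> alone, leaving the Hilbert
      kernel.\<close>
    have "real (i + j + 1) powr (- 1 / q) = real (i + j + 1) powr (- s) / real (i + j + 1)"
      unfolding s(4) by (simp add: powr_diff powr_minus_divide)
    also have "\<dots> \<le> real (j + 1) powr (- s) / real (i + j + 1)"
      using s(1) by (intro divide_right_mono powr_mono2') auto
    finally have "G i j \<le> norm (taylor \<phi> i) * norm (taylor v j) * (real (j + 1) powr (- s) / real (i + j + 1))"
      unfolding G_def by (intro mult_left_mono) auto
    then show "G i j \<le> norm (taylor \<phi> i) * (real (j + 1) powr (- s) * norm (taylor v j)) / real (i + j + 1)"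
      by (simp add: mult_ac)
  qed
  also have "\<dots> \<le> 4 * (\<Sum>i<K. (norm (taylor \<phi> i))\<^sup>2) + 4 * (\<Sum>j<K. (real (j + 1) powr (- s) * norm (taylor v j))\<^sup>2)"
    by (rule hilbert_inequality_AM)
  also have "\<dots> \<le> 4 * A + 4 * ((1 + 2 * (1 + 2 * s)\<^sup>2 * 4 powr (2 * s + 2)) * A powr (1 + 2 * s))"
    by (intro add_mono mult_left_mono sum_\<phi> sum_v) auto
  finally show ?thesis unfolding s .
qed

text \<open>The polynomial estimate is applied to partial sums of \<open>f\<close>, dilated by a
  radius below 1. Its constant depends only on \<open>q\<close> and \<open>A\<close>, so the bound
  for the sums with the extra factor \<open>x ^ k\<close> survives \<open>x\<close> tending to
  1.\<close>

lemma weighted_coeff_summable: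
  fixes q :: real
  assumes q: "0 < q" "q \<le> 1"
    and f: "\<And>z. norm z < 1 \<Longrightarrow> (\<lambda>k. a k * z ^ k) sums f z"
    and A: "\<And>r. 0 < r \<Longrightarrow> r < 1 \<Longrightarrow> circle_mean (\<lambda>z. norm (f z) powr q) r \<le> A"
  shows "summable (\<lambda>k. norm (a k) * real (k + 1) powr (- 1 / q))"
proof -
  have holf: "f holomorphic_on ball 0 1"
    using f by (intro power_series_holomorphic[of 0 1 a]) auto
  have contf: "continuous_on (sphere 0 r) f" if "r < 1" for r
    using that by (intro holomorphic_on_imp_continuous_on holomorphic_on_subset[OF holf]) auto
  have contq: "continuous_on S (\<lambda>z. norm (h z) powr q)" if "continuous_on S h" for S and h :: "complex \<Rightarrow> complex"
    using q that by (intro continuous_on_powr' continuous_intros) auto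
  have tay: "taylor f = a"
    using f by (intro taylor_unique[of 1]) auto
  \<comment> \<open>Bounds the means of the partial sums used below, which differ from
    \<open>f\<close> by less than 1, via
    \<open>(x + 1) powr q \<le> 2 * x powr q + 2\<close>.\<close>
  define B where "B = 2 * A + 2"
  define C where "C = 4 * B + 4 * ((1 + 2 * (2 / q - 1)\<^sup>2 * 4 powr (2 / q)) * B powr (2 / q - 1))"
  have "0 \<le> circle_mean (\<lambda>z. norm (f z) powr q) (1 / 2)"
    by (intro circle_mean_nonneg contq contf) auto
  then have "0 \<le> A" using A[of "1 / 2"] by simp
  then have "0 \<le> C" by (simp add: C_def B_def)
  have powr_le: "(x + 1) powr q \<le> 2 * x powr q + 2" if "0 \<le> x" for x :: real
  proof -
    have two: "2 powr q \<le> (2 :: real)" using powr_mono[of q 1 2] q by simp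
    show ?thesis
    proof (cases "x \<le> 1")
      case True
      have "(x + 1) powr q \<le> 2 powr q" using True that q by (intro powr_mono2) auto
      with two show ?thesis by (smt (verit) powr_ge_zero)
    next
      case False
      have "(x + 1) powr q \<le> (2 * x) powr q" using False q by (intro powr_mono2) auto
      also have "\<dots> = 2 powr q * x powr q" using that by (simp add: powr_mult)
      also have "\<dots> \<le> 2 * x powr q" using two by (intro mult_right_mono) auto
      finally show ?thesis by simp
    qed
  qed
  have bound: "(\<Sum>k<K. norm (a k) * x ^ k * real (k + 1) powr (- 1 / q)) \<le> C" if x: "0 < x" "x < 1" for x :: real and K
  proof -
    obtain r where r: "x < r" "r < 1" using x(2) dense by blast
    have "uniform_limit (cball 0 r) (\<lambda>N z. \<Sum>n<N. a n * z ^ n) f sequentially"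
      using taylor_uniform_limit[OF holf, of r] r x by (simp add: tay)
    from uniform_limitD[OF this, of 1]
    have "\<forall>\<^sub>F N in sequentially. \<forall>z\<in>cball 0 r. dist (\<Sum>n<N. a n * z ^ n) (f z) < 1" by simp
    then have "\<forall>\<^sub>F N in sequentially. (\<forall>z\<in>cball 0 r. dist (\<Sum>n<N. a n * z ^ n) (f z) < 1) \<and> K \<le> N"
      using eventually_ge_at_top by (rule eventually_conj)
    then obtain N where N: "K \<le> N" "\<And>z. norm z \<le> r \<Longrightarrow> dist (\<Sum>n<N. a n * z ^ n) (f z) < 1"
      by (auto simp: eventually_sequentially)
    define P where "P = (\<Sum>k<N. monom (a k) k)"
    have coeff_P: "coeff P k = a k" if "k < N" for k
      using that by (simp add: P_def coeff_sum coeff_monom if_distrib cong: if_cong)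
    have poly_P: "poly P z = (\<Sum>k<N. a k * z ^ k)" for z
      by (simp add: P_def poly_sum poly_monom)
    show ?thesis
    proof (cases "P = 0")
      case True
      then have "a k = 0" if "k < K" for k using coeff_P[of k] that N(1) by simp
      then show ?thesis using \<open>0 \<le> C\<close> by simp
    next
      case False
      \<comment> \<open>A nonzero polynomial excludes only finitely many radii, so some \<rho>
        between \<open>x\<close> and \<open>r\<close> gives a dilation without zeros on the unit
        circle.\<close>
      have "infinite ({x<..<r} - norm ` {z. poly P z = 0})"
        using r poly_roots_finite[OF False] by (intro Diff_infinite_finite) auto
      then obtain \<rho> where \<rho>: "x < \<rho>" "\<rho> < r" "\<rho> \<notin> norm ` {z. poly P z = 0}"
        by (metis Diff_iff greaterThanLessThan_iff infinite_imp_nonempty ex_in_conv)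
      define Q where "Q = (\<Sum>k<N. monom (a k * of_real \<rho> ^ k) k)"
      have coeff_Q: "coeff Q k = a k * of_real \<rho> ^ k" if "k < N" for k
        using that by (simp add: Q_def coeff_sum coeff_monom if_distrib cong: if_cong)
      have poly_Q: "poly Q z = poly P (of_real \<rho> * z)" for z
        by (simp add: Q_def poly_P poly_sum poly_monom power_mult_distrib mult.assoc)
      have "poly Q z \<noteq> 0" if "norm z = 1" for z
        using \<rho>(3) x \<rho>(1) that unfolding poly_Q by (force simp: norm_mult image_iff)
      moreover have "circle_mean (\<lambda>z. norm (poly Q z) powr q) 1 \<le> B"
      proof -
        have "circle_mean (\<lambda>z. norm (poly Q z) powr q) 1 = circle_mean (\<lambda>z. norm (poly P z) powr q) \<rho>"
          by (simp add: circle_mean_def poly_Q)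
        also have "\<dots> \<le> circle_mean (\<lambda>z. 2 * (norm (f z) powr q) + 2) \<rho>"
        proof (intro circle_mean_mono contq continuous_intros contf)
          fix z :: complex assume "norm z = \<rho>"
          then have "dist (poly P z) (f z) < 1" using N(2)[of z] \<rho> by (simp add: poly_P)
          then have "norm (poly P z) \<le> norm (f z) + 1"
            by (smt (verit) dist_norm norm_triangle_ineq2)
          then have "norm (poly P z) powr q \<le> (norm (f z) + 1) powr q"
            using q by (intro powr_mono2) auto
          also have "\<dots> \<le> 2 * (norm (f z) powr q) + 2" by (intro powr_le) simp
          finally show "norm (poly P z) powr q \<le> 2 * (norm (f z) powr q) + 2" .
        qed (use \<rho> r x in auto)
        also have "\<dots> = 2 * circle_mean (\<lambda>z. norm (f z) powr q) \<rho> + 2"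
          using \<rho> r x by (subst circle_mean_add) (auto simp: circle_mean_cmult circle_mean_const intro!: contq contf continuous_on_mult_left)
        also have "\<dots> \<le> B" using A[of \<rho>] \<rho> r x by (simp add: B_def)
        finally show ?thesis .
      qed
      ultimately have "(\<Sum>k<K. norm (coeff Q k) * real (k + 1) powr (- 1 / q)) \<le> C"
        unfolding C_def by (intro weighted_coeff_bound_poly q)
      moreover have "(\<Sum>k<K. norm (a k) * x ^ k * real (k + 1) powr (- 1 / q)) \<le>
          (\<Sum>k<K. norm (coeff Q k) * real (k + 1) powr (- 1 / q))"
        using N(1) x \<rho>(1)
        by (intro sum_mono mult_right_mono) (auto simp: coeff_Q norm_mult norm_power intro!: mult_left_mono power_mono)
      ultimately show ?thesis by linarith
    qed
  qed
  have "(\<Sum>k<K. norm (a k) * real (k + 1) powr (- 1 / q)) \<le> C" for K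
  proof (rule tendsto_upperbound)
    show "((\<lambda>x. \<Sum>k<K. norm (a k) * x ^ k * real (k + 1) powr (- 1 / q)) \<longlongrightarrow>
        (\<Sum>k<K. norm (a k) * real (k + 1) powr (- 1 / q))) (at_left 1)"
      by (auto intro!: tendsto_eq_intros)
    show "\<forall>\<^sub>F x in at_left 1. (\<Sum>k<K. norm (a k) * x ^ k * real (k + 1) powr (- 1 / q)) \<le> C"
      unfolding eventually_at_left_field using bound by (intro exI[of _ 0]) auto
  qed simp
  then show ?thesis by (intro summableI_nonneg_bounded) auto
qed

section \<open>Moments of Carleson measures\<close>

lemma space_borel_measure_on_unit:
  assumes "borel_measure_on_unit \<mu>"
  shows "space \<mu> = {0..<1}"
  using sets_eq_imp_space_eq[OF assms[unfolded borel_measure_on_unit_def]] by (simp add: space_restrict_space)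

lemma carleson_measure_finite:
  assumes "carleson_measure \<sigma> \<mu>"
  shows "finite_measure \<mu>"
proof (rule finite_measureI)
  obtain C where "\<forall>t. 0 \<le> t \<and> t < 1 \<longrightarrow> emeasure \<mu> {t..<1} \<le> ennreal (C * (1 - t) powr \<sigma>)"
    using assms by (auto simp: carleson_measure_def)
  from this[rule_format, of 0] have "emeasure \<mu> {0..<1} < \<infinity>"
    by (auto simp: le_less_trans less_top)
  then show "emeasure \<mu> (space \<mu>) \<noteq> \<infinity>"
    using assms by (simp add: carleson_measure_def space_borel_measure_on_unit)
qed

lemma borel_measurable_on_unit:
  assumes "borel_measure_on_unit \<mu>" "h \<in> borel_measurable borel"
  shows "h \<in> borel_measurable \<mu>"
  using assms measurable_restrict_space1[OF assms(2), of "{0..<1}"]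
  by (simp add: borel_measure_on_unit_def cong: measurable_cong_sets)

lemma integrable_power_on_unit:
  assumes "borel_measure_on_unit \<mu>" "finite_measure \<mu>"
  shows "integrable \<mu> (\<lambda>t. t ^ n)"
proof -
  interpret finite_measure \<mu> by fact
  have "norm (t ^ n) \<le> 1" if "t \<in> space \<mu>" for t
    using that assms(1) by (auto simp: space_borel_measure_on_unit norm_power intro: power_le_one)
  then show ?thesis
    by (intro integrable_const_bound[where B = 1] AE_I2 borel_measurable_on_unit[OF assms(1)]) auto
qed

text \<open>With \<open>N = n + 1\<close>, the function \<open>t ^ n\<close> is of order at most
  \<open>exp (- m)\<close> at distance about \<open>m / N\<close> from 1, while the Carleson
  condition bounds the measure of that neighbourhood of 1 by a multiple of
  \<open>(m / N) powr \<sigma>\<close>. The sum of \<open>exp (- m) * m powr \<sigma>\<close> over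
  \<open>m\<close> is bounded independently of \<open>n\<close>.\<close>

lemma carleson_moment_bound:
  assumes \<sigma>: "0 < \<sigma>" and \<mu>: "carleson_measure \<sigma> \<mu>"
  obtains C where "\<And>n. moment \<mu> n \<le> C * real (n + 1) powr (- \<sigma>)"
proof -
  obtain C0 where C0: "0 < C0" "\<And>t. 0 \<le> t \<Longrightarrow> t < 1 \<Longrightarrow> emeasure \<mu> {t..<1} \<le> ennreal (C0 * (1 - t) powr \<sigma>)"
    and unit: "borel_measure_on_unit \<mu>"
    using \<mu> by (auto simp: carleson_measure_def)
  interpret finite_measure \<mu> by (rule carleson_measure_finite[OF \<mu>])
  \<comment> \<open>Half of the exponential decay is spent on absorbing
    \<open>m powr \<sigma>\<close>; the other half leaves a geometric series of ratio
    \<open>E\<close>.\<close>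
  define E where "E = exp (- 1 / 2 :: real)"
  define D where "D = C0 * exp 2 * (2 * \<sigma>) powr \<sigma> * (1 / (1 - E))"
  have E: "0 < E" "E < 1" by (auto simp: E_def)
  have "moment \<mu> n \<le> D * real (n + 1) powr (- \<sigma>)" for n
  proof -
    define N where "N = n + 1"
    have N: "real N > 0" by (simp add: N_def)
    let ?A = "\<lambda>m::nat. {1 - real m / real N..<1}"
    let ?c = "\<lambda>m::nat. exp (2 - real m)"
    have A_sets: "?A m \<in> sets \<mu>" if "m \<in> {1..N}" for m
      using unit that by (auto simp: borel_measure_on_unit_def sets_restrict_space_iff N_def divide_simps)
    have pointwise: "t ^ n \<le> (\<Sum>m = 1..N. ?c m * indicator (?A m) t)" if t: "t \<in> space \<mu>" for t
    proof -
      have t: "0 \<le> t" "t < 1" using t unit by (auto simp: space_borel_measure_on_unit)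
      \<comment> \<open>The point \<open>t\<close> lies in \<open>?A m\<close> for this
        \<open>m\<close>, and \<open>m < N * (1 - t) + 1\<close> together with
        \<open>t \<ge> 0\<close> gives the exponent \<open>2 - m\<close>.\<close>
      define m where "m = nat \<lceil>real N * (1 - t)\<rceil>"
      have y: "0 < real N * (1 - t)" "real N * (1 - t) \<le> real N" using N t by (auto intro: mult_left_le)
      have m: "real m \<ge> real N * (1 - t)" "real m < real N * (1 - t) + 1"
        using y(1) unfolding m_def by linarith+
      have "m \<in> {1..N}" using m y by (auto simp: Suc_le_eq)
      have "1 - real m / real N \<le> t" using m(1) N by (simp add: field_simps)
      have "t ^ n \<le> exp (t - 1) ^ n"
        using exp_ge_add_one_self[of "t - 1"] t by (intro power_mono) auto
      also have "\<dots> = exp (1 - t - real N * (1 - t))"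
        by (simp add: exp_of_nat_mult[symmetric] N_def algebra_simps)
      also have "\<dots> \<le> ?c m" using m(2) t by simp
      also have "\<dots> = ?c m * indicator (?A m) t"
        using \<open>1 - real m / real N \<le> t\<close> t by simp
      also have "\<dots> \<le> (\<Sum>m = 1..N. ?c m * indicator (?A m) t)"
        using \<open>m \<in> {1..N}\<close> by (intro member_le_sum) auto
      finally show ?thesis .
    qed
    have measure_le: "measure \<mu> (?A m) \<le> C0 * (real m / real N) powr \<sigma>" if "m \<in> {1..N}" for m
    proof -
      have "0 \<le> 1 - real m / real N" "1 - real m / real N < 1" using that N by auto
      from C0(2)[OF this] show ?thesis
        using C0(1) by (simp add: emeasure_eq_measure)
    qed
    have decay: "?c m * real m powr \<sigma> \<le> exp 2 * (2 * \<sigma>) powr \<sigma> * E ^ m" for m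
    proof -
      \<comment> \<open>The inequality \<open>y \<le> exp y\<close> at
        \<open>y = m / (2 * \<sigma>)\<close>, raised to the power \<sigma>, bounds
        \<open>m powr \<sigma>\<close> by a multiple of \<open>exp (m / 2)\<close>.\<close>
      have "real m / (2 * \<sigma>) \<le> exp (real m / (2 * \<sigma>))"
        using exp_ge_add_one_self[of "real m / (2 * \<sigma>)"] by linarith
      then have "(real m / (2 * \<sigma>)) powr \<sigma> \<le> exp (real m / (2 * \<sigma>)) powr \<sigma>"
        using \<sigma> by (intro powr_mono2) auto
      also have "\<dots> = exp (real m / 2)"
        using \<sigma> by (simp add: powr_def)
      finally have "real m powr \<sigma> \<le> (2 * \<sigma>) powr \<sigma> * exp (real m / 2)"
        using \<sigma> by (simp add: powr_divide field_simps)
      then have "?c m * real m powr \<sigma> \<le> ?c m * ((2 * \<sigma>) powr \<sigma> * exp (real m / 2))"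
        by (intro mult_left_mono) auto
      also have "\<dots> = (2 * \<sigma>) powr \<sigma> * (exp (2 - real m) * exp (real m / 2))" by simp
      also have "exp (2 - real m) * exp (real m / 2) = exp 2 * E ^ m"
        by (simp add: E_def exp_of_nat_mult[symmetric] exp_add[symmetric])
      finally show ?thesis by (simp add: mult_ac)
    qed
    have int: "integrable \<mu> (\<lambda>t. ?c m * indicator (?A m) t)" if "m \<in> {1..N}" for m
      using A_sets[OF that] by (intro integrable_mult_right integrable_real_indicator) (auto simp: less_top[symmetric])
    have "moment \<mu> n \<le> (LINT t|\<mu>. (\<Sum>m = 1..N. ?c m * indicator (?A m) t))"
      unfolding moment_def
      by (intro integral_mono integrable_power_on_unit unit finite_measure_axioms Bochner_Integration.integrable_sum int pointwise)
    also have "\<dots> = (\<Sum>m = 1..N. ?c m * measure \<mu> (?A m))"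
      using int A_sets by (subst Bochner_Integration.integral_sum) auto
    also have "\<dots> \<le> (\<Sum>m = 1..N. ?c m * (C0 * (real m / real N) powr \<sigma>))"
      by (intro sum_mono mult_left_mono measure_le) auto
    also have "\<dots> = C0 * real N powr (- \<sigma>) * (\<Sum>m = 1..N. ?c m * real m powr \<sigma>)"
      using N by (simp add: sum_distrib_left powr_divide powr_minus field_simps)
    also have "\<dots> \<le> C0 * real N powr (- \<sigma>) * (\<Sum>m = 1..N. exp 2 * (2 * \<sigma>) powr \<sigma> * E ^ m)"
      using C0 by (intro mult_left_mono sum_mono decay) auto
    also have "\<dots> = C0 * real N powr (- \<sigma>) * (exp 2 * (2 * \<sigma>) powr \<sigma> * (\<Sum>m = 1..N. E ^ m))"
      by (simp add: sum_distrib_left)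
    also have "\<dots> \<le> C0 * real N powr (- \<sigma>) * (exp 2 * (2 * \<sigma>) powr \<sigma> * (1 / (1 - E)))"
      using sum_le_suminf[of "\<lambda>m. E ^ m" "{1..N}"] E C0
      by (intro mult_left_mono) (auto simp: suminf_geometric)
    finally show ?thesis by (simp add: D_def N_def mult_ac)
  qed
  then show ?thesis using that by blast
qed

section \<open>Integral representation\<close>

text \<open>Termwise integration of an absolutely convergent series. As
  \<open>t ^ (n + k) \<le> t ^ k\<close> on the unit interval, the summability hypothesis, which
  concerns \<open>n = 0\<close>, serves every \<open>n\<close>. Integrability is recorded for the
  second interchange.\<close>

lemma moment_series_eq_integral:
  fixes a :: "nat \<Rightarrow> complex"
  assumes unit: "borel_measure_on_unit \<mu>" and fin: "finite_measure \<mu>"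
    and f: "\<And>z. norm z < 1 \<Longrightarrow> (\<lambda>k. a k * z ^ k) sums f z"
    and summ: "summable (\<lambda>k. norm (a k) * moment \<mu> k)"
  shows "integrable \<mu> (\<lambda>t. of_real t ^ n * f (of_real t))"
    and "(\<lambda>k. of_real (moment \<mu> (n + k)) * a k) sums (LINT t|\<mu>. of_real t ^ n * f (of_real t))"
proof -
  let ?F = "\<lambda>k t. of_real (t ^ (n + k)) * a k"
  have space: "space \<mu> = {0..<1}" by (rule space_borel_measure_on_unit[OF unit])
  have int: "integrable \<mu> (\<lambda>t. t ^ j)" for j :: nat by (rule integrable_power_on_unit[OF unit fin])
  have intF: "integrable \<mu> (?F k)" for k
    by (intro integrable_mult_left integrable_of_real int)
  have sums_pt: "(\<lambda>k. ?F k t) sums (of_real t ^ n * f (of_real t))" if "t \<in> space \<mu>" for t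
    using sums_mult[OF f[of "of_real t"], of "of_real t ^ n"] that
    by (simp add: space power_add mult_ac)
  have "summable (\<lambda>k. norm (?F k t))" if "t \<in> space \<mu>" for t
  proof -
    have t: "0 \<le> t" "t < 1" using that by (auto simp: space)
    then obtain x where "t < x" "x < 1" using dense by blast
    with t have "summable (\<lambda>k. norm (a k * of_real t ^ k))"
      by (intro powser_insidea[of a "of_real x"] sums_summable[OF f]) auto
    from summable_mult[OF this, of "t ^ n"] show ?thesis
      using t by (simp add: norm_mult norm_power power_add mult_ac)
  qed
  then have AE_F: "AE t in \<mu>. summable (\<lambda>k. norm (?F k t))" by auto
  have "summable (\<lambda>k. LINT t|\<mu>. norm (?F k t))"
  proof (rule summable_comparison_test'[OF summ, of 0])
    fix k
    have "(LINT t|\<mu>. norm (?F k t)) = (LINT t|\<mu>. norm (a k) * t ^ (n + k))"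
      by (intro Bochner_Integration.integral_cong refl) (auto simp: space norm_mult norm_power)
    also have "\<dots> \<le> (LINT t|\<mu>. norm (a k) * t ^ k)"
      by (intro integral_mono integrable_mult_right int mult_left_mono power_decreasing) (auto simp: space)
    finally show "norm (LINT t|\<mu>. norm (?F k t)) \<le> norm (a k) * moment \<mu> k"
      by (simp add: moment_def)
  qed
  note * = intF AE_F this
  have eq: "(\<Sum>k. ?F k t) = of_real t ^ n * f (of_real t)" if "t \<in> space \<mu>" for t
    using sums_pt[OF that] by (rule sums_unique[symmetric])
  have "integrable \<mu> (\<lambda>t. (\<Sum>k. ?F k t)) = integrable \<mu> (\<lambda>t. of_real t ^ n * f (of_real t))"
    by (rule Bochner_Integration.integrable_cong[OF refl eq])
  then show "integrable \<mu> (\<lambda>t. of_real t ^ n * f (of_real t))"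
    using integrable_suminf[OF *] by (rule iffD1)
  have int_eq: "(LINT t|\<mu>. (\<Sum>k. ?F k t)) = (LINT t|\<mu>. of_real t ^ n * f (of_real t))"
    by (rule Bochner_Integration.integral_cong[OF refl eq])
  have "(\<lambda>k. LINT t|\<mu>. ?F k t) sums (LINT t|\<mu>. of_real t ^ n * f (of_real t))"
    using sums_integral[OF *] unfolding int_eq .
  moreover have "(LINT t|\<mu>. ?F k t) = of_real (moment \<mu> (n + k)) * a k" for k
    by (simp only: integral_mult_left_zero integral_complex_of_real moment_def)
  ultimately show "(\<lambda>k. of_real (moment \<mu> (n + k)) * a k) sums (LINT t|\<mu>. of_real t ^ n * f (of_real t))"
    by (simp only:)
qed

text \<open>The kernel expands into the series of \<open>(n + 1) * (t * z) ^ n\<close>. Multiplied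
  by \<open>f\<close>, its terms are dominated by \<open>(n + 1) * norm z ^ n * norm (f t)\<close>,
  and \<open>f\<close> is integrable by \<open>moment_series_eq_integral\<close> with
  \<open>n = 0\<close>, so the sum may again be taken outside the integral.\<close>

lemma DH_series_eq_integral:
  assumes unit: "borel_measure_on_unit \<mu>" and fin: "finite_measure \<mu>"
    and f: "\<And>z. norm z < 1 \<Longrightarrow> (\<lambda>k. a k * z ^ k) sums f z"
    and summ: "summable (\<lambda>k. norm (a k) * moment \<mu> k)"
    and z: "norm z < 1"
  shows "integrable \<mu> (\<lambda>t. f (of_real t) / (1 - of_real t * z)\<^sup>2)"
    and "(\<lambda>n. DH_coeff \<mu> a n * z ^ n) sums (LINT t|\<mu>. f (of_real t) / (1 - of_real t * z)\<^sup>2)"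
proof -
  note coeff = moment_series_eq_integral[OF unit fin f summ]
  let ?G = "\<lambda>n t. of_nat (Suc n) * z ^ n * (of_real t ^ n * f (of_real t))"
  have space: "space \<mu> = {0..<1}" by (rule space_borel_measure_on_unit[OF unit])
  have tz: "norm (of_real t * z) < 1" if "t \<in> space \<mu>" for t :: real
    using that z mult_le_one[of t "norm z"] mult_left_le_one_le[of "norm z" t] by (simp add: norm_mult space)
  have sums_pt: "(\<lambda>n. ?G n t) sums (f (of_real t) / (1 - of_real t * z)\<^sup>2)" if "t \<in> space \<mu>" for t
    using sums_mult2[OF geometric_deriv_sums[OF tz[OF that]], of "f (of_real t)"]
    by (simp add: power_mult_distrib mult_ac del: of_nat_Suc)
  have S: "summable (\<lambda>n. real (Suc n) * norm z ^ n)"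
    using sums_summable[OF geometric_deriv_sums[of "norm z"]] z by simp
  have int_f: "integrable \<mu> (\<lambda>t. f (of_real t))" using coeff(1)[of 0] by simp
  have norm_G: "norm (?G n t) \<le> real (Suc n) * norm z ^ n * norm (f (of_real t))" if "t \<in> space \<mu>" for n t
  proof -
    have "t ^ n * norm (f (of_real t)) \<le> norm (f (of_real t))"
      using that by (intro mult_left_le_one_le power_le_one) (auto simp: space)
    then have "real (Suc n) * norm z ^ n * (t ^ n * norm (f (of_real t))) \<le> real (Suc n) * norm z ^ n * norm (f (of_real t))"
      by (intro mult_left_mono) auto
    moreover have "\<bar>t\<bar> = t" using that by (simp add: space)
    ultimately show ?thesis
      by (simp only: norm_mult norm_power norm_of_nat norm_of_real)
  qed
  have "summable (\<lambda>n. norm (?G n t))" if "t \<in> space \<mu>" for t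
    using norm_G[OF that]
    by (intro summable_comparison_test'[OF summable_mult2[OF S, of "norm (f (of_real t))"], of 0]) auto
  then have AE_G: "AE t in \<mu>. summable (\<lambda>n. norm (?G n t))" by auto
  have intG: "integrable \<mu> (?G n)" for n by (intro integrable_mult_right coeff(1))
  have "summable (\<lambda>n. LINT t|\<mu>. norm (?G n t))"
  proof (rule summable_comparison_test'[OF summable_mult2[OF S, of "LINT t|\<mu>. norm (f (of_real t))"], of 0])
    fix n
    have "(LINT t|\<mu>. norm (?G n t)) \<le> (LINT t|\<mu>. real (Suc n) * norm z ^ n * norm (f (of_real t)))"
      by (intro integral_mono integrable_norm intG integrable_mult_right int_f norm_G)
    then show "norm (LINT t|\<mu>. norm (?G n t)) \<le> real (Suc n) * norm z ^ n * (LINT t|\<mu>. norm (f (of_real t)))"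
      by (simp del: of_nat_Suc)
  qed
  note * = intG AE_G this
  have eq: "(\<Sum>n. ?G n t) = f (of_real t) / (1 - of_real t * z)\<^sup>2" if "t \<in> space \<mu>" for t
    using sums_pt[OF that] by (rule sums_unique[symmetric])
  have "integrable \<mu> (\<lambda>t. (\<Sum>n. ?G n t)) = integrable \<mu> (\<lambda>t. f (of_real t) / (1 - of_real t * z)\<^sup>2)"
    by (rule Bochner_Integration.integrable_cong[OF refl eq])
  then show "integrable \<mu> (\<lambda>t. f (of_real t) / (1 - of_real t * z)\<^sup>2)"
    using integrable_suminf[OF *] by (rule iffD1)
  have int_eq: "(LINT t|\<mu>. (\<Sum>n. ?G n t)) = (LINT t|\<mu>. f (of_real t) / (1 - of_real t * z)\<^sup>2)"
    by (rule Bochner_Integration.integral_cong[OF refl eq])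
  have "(\<lambda>n. LINT t|\<mu>. ?G n t) sums (LINT t|\<mu>. f (of_real t) / (1 - of_real t * z)\<^sup>2)"
    using sums_integral[OF *] unfolding int_eq .
  moreover have "(LINT t|\<mu>. ?G n t) = DH_coeff \<mu> a n * z ^ n" for n
    by (simp only: integral_mult_right_zero DH_coeff_def sums_unique[OF coeff(2), symmetric] Suc_eq_plus1)
      (simp only: mult_ac)
  ultimately show "(\<lambda>n. DH_coeff \<mu> a n * z ^ n) sums (LINT t|\<mu>. f (of_real t) / (1 - of_real t * z)\<^sup>2)"
    by (simp only:)
qed

section \<open>Bounded means of Hardy space functions and the conclusion for all exponents\<close>

lemma hardy_space_circle_mean_bound:
  assumes p: "0 < p" and f: "f \<in> hardy_space p"
  obtains A where "\<And>r. 0 < r \<Longrightarrow> r < 1 \<Longrightarrow> circle_mean (\<lambda>z. norm (f z) powr p) r \<le> A"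
proof -
  have hol: "f holomorphic_on ball 0 1"
    using f by (auto simp: hardy_space_def intro: analytic_imp_holomorphic)
  have "hardy_norm p f < \<infinity>" using f by (simp add: hardy_space_def)
  then obtain B where B: "0 \<le> B" "hardy_norm p f = ennreal B"
    by (cases "hardy_norm p f") auto
  have "circle_mean (\<lambda>z. norm (f z) powr p) r \<le> B powr p" if r: "0 < r" "r < 1" for r
  proof -
    let ?m = "circle_mean (\<lambda>z. norm (f z) powr p) r"
    have "continuous_on (sphere 0 r) f"
      using r by (intro holomorphic_on_imp_continuous_on holomorphic_on_subset[OF hol]) auto
    then have "0 \<le> ?m"
      using p r by (intro circle_mean_nonneg continuous_on_powr' continuous_intros) auto
    have "ennreal (?m powr (1 / p)) \<le> hardy_norm p f"
      unfolding hardy_norm_def circle_mean_def using r by (intro SUP_upper) auto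
    then have "?m powr (1 / p) \<le> B"
      using B by simp
    then have "(?m powr (1 / p)) powr p \<le> B powr p"
      using p by (intro powr_mono2) auto
    then show ?thesis using \<open>0 \<le> ?m\<close> p by (simp add: powr_powr)
  qed
  then show ?thesis using that by blast
qed

theorem theorem3p1:
  fixes p :: real and \<mu> :: "real measure"
  assumes "0 < p"
    and "borel_measure_on_unit \<mu>"
    and "(0 < p \<and> p \<le> 1 \<and> carleson_measure (1 / p) \<mu>) \<or> (1 < p \<and> carleson_measure 1 \<mu>)"
  shows "\<forall>f a. f \<in> hardy_space p \<and> (\<forall>z\<in>ball 0 1. (\<lambda>k. a k * z ^ k) sums f z) \<longrightarrow>
           (\<forall>n. summable (\<lambda>k. of_real (moment \<mu> (n + k)) * a k)) \<and>
           (\<forall>z\<in>ball 0 1. summable (\<lambda>n. DH_coeff \<mu> a n * z ^ n)) \<and>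
           DH \<mu> a analytic_on ball 0 1 \<and>
           (\<forall>z\<in>ball 0 1.
              integrable \<mu> (\<lambda>t. f (of_real t) / (1 - of_real t * z)\<^sup>2) \<and>
              DH \<mu> a z = (LINT t|\<mu>. f (of_real t) / (1 - of_real t * z)\<^sup>2))"
proof (intro allI impI, elim conjE)
  fix f :: "complex \<Rightarrow> complex" and a :: "nat \<Rightarrow> complex"
  assume fH: "f \<in> hardy_space p" and "\<forall>z\<in>ball 0 1. (\<lambda>k. a k * z ^ k) sums f z"
  then have f: "(\<lambda>k. a k * z ^ k) sums f z" if "norm z < 1" for z using that by auto
  \<comment> \<open>Treats both conditions at once: in either case \<mu> is a
    \<open>1 / q\<close>-Carleson measure, and the means of order \<open>q\<close> of
    \<open>f\<close> turn out to be bounded.\<close>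
  define q where "q = min p 1"
  have q: "0 < q" "q \<le> 1" using assms(1) by (auto simp: q_def)
  have \<mu>: "carleson_measure (1 / q) \<mu>" using assms(3) by (auto simp: q_def min_def)
  obtain A where A: "\<And>r. 0 < r \<Longrightarrow> r < 1 \<Longrightarrow> circle_mean (\<lambda>z. norm (f z) powr p) r \<le> A"
    using hardy_space_circle_mean_bound[OF assms(1) fH] by blast
  have "circle_mean (\<lambda>z. norm (f z) powr q) r \<le> A + 1" if r: "0 < r" "r < 1" for r
  proof -
    have "f holomorphic_on ball 0 1"
      using fH by (auto simp: hardy_space_def intro: analytic_imp_holomorphic)
    then have "continuous_on (sphere 0 r) f"
      using r by (intro holomorphic_on_imp_continuous_on) (auto elim: holomorphic_on_subset)
    then have cont: "continuous_on (sphere 0 r) (\<lambda>z. norm (f z) powr s)" if "0 < s" for s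
      using that by (intro continuous_on_powr' continuous_intros) auto
    \<comment> \<open>An elementary pointwise form of the inclusion of \<open>H^p\<close> in
      \<open>H^q\<close> for \<open>q \<le> p\<close>, at the cost of the additive 1.\<close>
    have "x powr q \<le> x powr p + 1" if "0 \<le> x" for x :: real
    proof (cases "x \<le> 1")
      case True
      then have "x powr q \<le> 1" using that q by (intro powr_le1) auto
      then show ?thesis by (smt (verit) powr_ge_zero)
    next
      case False
      then have "x powr q \<le> x powr p" by (intro powr_mono) (auto simp: q_def)
      then show ?thesis by simp
    qed
    then have "circle_mean (\<lambda>z. norm (f z) powr q) r \<le> circle_mean (\<lambda>z. norm (f z) powr p + 1) r"
      using r q(1) assms(1) by (intro circle_mean_mono cont continuous_intros) auto
    also have "\<dots> = circle_mean (\<lambda>z. norm (f z) powr p) r + 1"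
      using r assms(1) by (subst circle_mean_add) (auto simp: circle_mean_const intro!: cont)
    finally show ?thesis using A[OF r] by linarith
  qed
  from weighted_coeff_summable[OF q f this]
  have weighted: "summable (\<lambda>k. norm (a k) * real (k + 1) powr (- 1 / q))" .
  obtain C where C: "\<And>n. moment \<mu> n \<le> C * real (n + 1) powr (- (1 / q))"
    using carleson_moment_bound[OF _ \<mu>] q by (metis divide_pos_pos zero_less_one)
  have moment_nonneg: "0 \<le> moment \<mu> k" for k
    unfolding moment_def using assms(2) by (intro integral_nonneg_AE) (auto simp: space_borel_measure_on_unit)
  \<comment> \<open>The moments are bounded by a multiple of \<open>(k + 1) powr (- 1 / q)\<close>,
    exactly the weight in \<open>weighted\<close>.\<close>
  have "summable (\<lambda>k. norm (a k) * moment \<mu> k)"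
  proof (rule summable_comparison_test'[OF summable_mult[OF weighted, of C], of 0])
    fix k
    have "norm (a k) * moment \<mu> k \<le> norm (a k) * (C * real (k + 1) powr (- (1 / q)))"
      by (intro mult_left_mono C) auto
    then show "norm (norm (a k) * moment \<mu> k) \<le> C * (norm (a k) * real (k + 1) powr (- 1 / q))"
      using moment_nonneg[of k] by (simp add: mult_ac)
  qed
  note hyps = assms(2) carleson_measure_finite[OF \<mu>] f this
  have DH_sums: "(\<lambda>n. DH_coeff \<mu> a n * z ^ n) sums DH \<mu> a z" if "norm z < 1" for z
    using DH_series_eq_integral(2)[OF hyps that] unfolding DH_def by (rule summable_sums[OF sums_summable])
  have "DH \<mu> a z = (LINT t|\<mu>. f (of_real t) / (1 - of_real t * z)\<^sup>2)" if "norm z < 1" for z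
    using sums_unique2[OF DH_sums[OF that] DH_series_eq_integral(2)[OF hyps that]] .
  moreover have "DH \<mu> a analytic_on ball 0 1"
    using DH_sums by (intro power_series_analytic[of 0 1 "DH_coeff \<mu> a"]) auto
  ultimately show "(\<forall>n. summable (\<lambda>k. of_real (moment \<mu> (n + k)) * a k)) \<and>
           (\<forall>z\<in>ball 0 1. summable (\<lambda>n. DH_coeff \<mu> a n * z ^ n)) \<and>
           DH \<mu> a analytic_on ball 0 1 \<and>
           (\<forall>z\<in>ball 0 1.
              integrable \<mu> (\<lambda>t. f (of_real t) / (1 - of_real t * z)\<^sup>2) \<and>
              DH \<mu> a z = (LINT t|\<mu>. f (of_real t) / (1 - of_real t * z)\<^sup>2))"
    using moment_series_eq_integral(2)[OF hyps] DH_series_eq_integral(1)[OF hyps] DH_sums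
    by (auto simp: sums_iff)
qed

end
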